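(* Consider the Group-R2 prior with $G$ groups of sizes $p_1,\dots,p_G$, parameters $a_G>0$, $a_2>0$, $c_g=a_G/p_g$, and $\sigma^2=1$ (as defined in the context). As $|b_{gl}|\to\infty$, the marginal prior density of $b_{gl}$ satisfies $$p(b_{gl})\sim\mathcal{O}\left(\frac{1}{|b_{gl}|^{2a_2+1}}\right).$$ In particular, when $0<a_2\le\tfrac12$, the marginal priors have heavier tails than the Cauchy distribution.
   Context: Group-R2 prior (with $\sigma^2=1$): $R^2\sim\mathrm{Beta}(Ga_G,a_2)$ and $\tau^2=R^2/(1-R^2)$; $\phi=(\phi_1,\dots,\phi_G)$ is symmetric Dirichlet with all concentration parameters equal to $a_G$; for each $g$, $\varphi_g=(\varphi_{g1},\dots,\varphi_{gp_g})$ is symmetric Dirichlet with all concentration parameters equal to $c_g$; the variables $\tau^2,\phi,\varphi_1,\dots,\varphi_G$ are mutually independent; and conditionally on them the coefficients $b_{gl}$ are independent with $b_{gl}\sim\mathrm{Normal}(0,\varphi_{gl}\phi_g\tau^2)$ (variance parametrization). The subscript in $a_G$ is only a label.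
   Formalization: At a_2 = 1/2 the marginal density has the same order as Cauchy, so "heavier tails" is proved there only as "at least as heavy up to a constant"; strictly heavier tails are proved for 0 < a_2 < 1/2. The O is proved as exact order (Theta). *)

theory Defs
  imports "HOL-Probability.Probability" "HOL-Library.Landau_Symbols"
begin

definition beta_distribution :: "real \<Rightarrow> real \<Rightarrow> real measure" where
  "beta_distribution a b = density lborel (\<lambda>x. ennreal
     (if 0 < x \<and> x < 1 then x powr (a - 1) * (1 - x) powr (b - 1) / Beta a b else 0))"

text \<open>
  The density of the Dirichlet distribution on the simplex in \<open>n\<close> coordinates is taken, as usual,
  with respect to Lebesgue measure in the first \<open>n - 1\<close> coordinates; the last coordinate is
  determined by the sum being \<open>1\<close>. For \<open>n = 1\<close> this is the point mass at the vector \<open>(1)\<close>.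
  Vectors of length \<open>n\<close> are functions on \<open>{..<n}\<close>, extended by \<open>undefined\<close>.
\<close>

definition dirichlet_density :: "nat \<Rightarrow> (nat \<Rightarrow> real) \<Rightarrow> (nat \<Rightarrow> real) \<Rightarrow> real" where
  "dirichlet_density n \<alpha> x =
     (if (\<forall>i<n. 0 < x i)
      then Gamma (\<Sum>i<n. \<alpha> i) / (\<Prod>i<n. Gamma (\<alpha> i)) * (\<Prod>i<n. x i powr (\<alpha> i - 1))
      else 0)"

definition simplex_point :: "nat \<Rightarrow> (nat \<Rightarrow> real) \<Rightarrow> (nat \<Rightarrow> real)" where
  "simplex_point n x = x(n - 1 := 1 - (\<Sum>i<n - 1. x i))"

definition dirichlet_distribution :: "nat \<Rightarrow> (nat \<Rightarrow> real) \<Rightarrow> (nat \<Rightarrow> real) measure" where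
  "dirichlet_distribution n \<alpha> =
     distr (density (PiM {..<n - 1} (\<lambda>_. lborel))
                    (\<lambda>x. ennreal (dirichlet_density n \<alpha> (simplex_point n x))))
           (PiM {..<n} (\<lambda>_. borel)) (simplex_point n)"

text \<open>The normal distribution is parametrized by its variance; variance \<open>0\<close> gives a point mass,
  and (irrelevant) negative arguments are treated in the same way.\<close>

definition normal_distribution :: "real \<Rightarrow> real \<Rightarrow> real measure" where
  "normal_distribution \<mu> v =
     (if 0 < v then density lborel (\<lambda>x. ennreal (normal_density \<mu> (sqrt v) x))
      else return borel \<mu>)"

text \<open>
  Groups are indexed by \<open>g < G\<close> and the coefficients of group \<open>g\<close> by \<open>l < p g\<close>.
  Points of the hyperparameter space are triples \<open>(\<tau>\<^sup>2, \<phi>, \<psi>)\<close>, where \<open>\<psi> g\<close> is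
  the vector of within-group proportions (written varphi\<open>\<^sub>g\<close> in the literature).
\<close>

type_synonym r2_hyper = "real \<times> (nat \<Rightarrow> real) \<times> (nat \<Rightarrow> nat \<Rightarrow> real)"

definition r2_hyper_space :: "nat \<Rightarrow> (nat \<Rightarrow> nat) \<Rightarrow> r2_hyper measure" where
  "r2_hyper_space G p =
     borel \<Otimes>\<^sub>M (PiM {..<G} (\<lambda>_. borel) \<Otimes>\<^sub>M PiM {..<G} (\<lambda>g. PiM {..<p g} (\<lambda>_. borel)))"

definition r2_coeff_index :: "nat \<Rightarrow> (nat \<Rightarrow> nat) \<Rightarrow> (nat \<times> nat) set" where
  "r2_coeff_index G p = (SIGMA g:{..<G}. {..<p g})"

definition r2_coeff_space :: "nat \<Rightarrow> (nat \<Rightarrow> nat) \<Rightarrow> (nat \<times> nat \<Rightarrow> real) measure" where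
  "r2_coeff_space G p = PiM (r2_coeff_index G p) (\<lambda>_. borel)"

definition tau2_law :: "nat \<Rightarrow> real \<Rightarrow> real \<Rightarrow> real measure" where
  "tau2_law G aG a2 = distr (beta_distribution (real G * aG) a2) borel (\<lambda>r. r / (1 - r))"

definition r2_hyper_law ::
    "nat \<Rightarrow> (nat \<Rightarrow> nat) \<Rightarrow> real \<Rightarrow> real \<Rightarrow> (nat \<Rightarrow> real) \<Rightarrow> r2_hyper measure" where
  "r2_hyper_law G p aG a2 c =
     tau2_law G aG a2 \<Otimes>\<^sub>M
       (dirichlet_distribution G (\<lambda>_. aG) \<Otimes>\<^sub>M
        PiM {..<G} (\<lambda>g. dirichlet_distribution (p g) (\<lambda>_. c g)))"

text \<open>Conditional law of the coefficients given the hyperparameters, with error variance \<open>1\<close>.\<close>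

definition r2_coeff_law ::
    "nat \<Rightarrow> (nat \<Rightarrow> nat) \<Rightarrow> r2_hyper \<Rightarrow> (nat \<times> nat \<Rightarrow> real) measure" where
  "r2_coeff_law G p = (\<lambda>(\<tau>2, \<phi>, \<psi>).
     PiM (r2_coeff_index G p) (\<lambda>(g, l). normal_distribution 0 (\<psi> g l * \<phi> g * \<tau>2)))"

text \<open>Joint law of hyperparameters and coefficients.\<close>

definition group_r2_prior ::
    "nat \<Rightarrow> (nat \<Rightarrow> nat) \<Rightarrow> real \<Rightarrow> real \<Rightarrow> (nat \<Rightarrow> real) \<Rightarrow>
     (r2_hyper \<times> (nat \<times> nat \<Rightarrow> real)) measure" where
  "group_r2_prior G p aG a2 c =
     r2_hyper_law G p aG a2 c \<bind> (\<lambda>\<theta>.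
     r2_coeff_law G p \<theta> \<bind> (\<lambda>b.
     return (r2_hyper_space G p \<Otimes>\<^sub>M r2_coeff_space G p) (\<theta>, b)))"

definition coeff_marginal ::
    "nat \<Rightarrow> (nat \<Rightarrow> nat) \<Rightarrow> real \<Rightarrow> real \<Rightarrow> (nat \<Rightarrow> real) \<Rightarrow> nat \<Rightarrow> nat \<Rightarrow> real measure" where
  "coeff_marginal G p aG a2 c g l =
     distr (group_r2_prior G p aG a2 c) borel (\<lambda>(\<theta>, b). b (g, l))"

text \<open>
  A density is determined only up to null sets, so that asymptotics at infinity are meaningful only
  for a canonical version. We take the version that is continuous away from the origin, which is
  unique there. Continuity at the origin is not required: there the marginal densities of
  continuous scale mixtures of normals may have a pole.
\<close>

definition is_density_of :: "(real \<Rightarrow> real) \<Rightarrow> real measure \<Rightarrow> bool" where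
  "is_density_of f \<mu> \<longleftrightarrow>
     f \<in> borel_measurable borel \<and> (\<forall>x. 0 \<le> f x) \<and> continuous_on (- {0}) f \<and>
     \<mu> = density lborel (\<lambda>x. ennreal (f x))"

definition cauchy_density :: "real \<Rightarrow> real" where
  "cauchy_density x = 1 / (pi * (1 + x\<^sup>2))"

end

theory Submission
  imports Defs
begin

text \<open>
  Given the hyperparameters, \<open>b\<close> is normal with variance \<open>W \<tau>\<^sup>2\<close>, where \<open>W = \<psi> g l * \<phi> g\<close> lies in
  \<open>(0, 1]\<close> and is independent of \<open>\<tau>\<^sup>2\<close>. A mixture of centred normals has a density that is continuous
  away from \<open>0\<close>, since the normal density at \<open>x\<close> is at most \<open>1 / \<bar>x\<bar>\<close> whatever the variance. For
  fixed \<open>W = w\<close>, writing \<open>q = 1 - R\<^sup>2\<close> and \<open>y = x\<^sup>2 / w\<close>, the mixture over \<open>\<tau>\<^sup>2 = (1 - q) / q\<close> is \<open>w powr (- 1/2)\<close>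
  times an integral of \<open>q powr (a\<^sub>2 - 1/2) * exp (- y q / (2 (1 - q)))\<close> (and a power of \<open>1 - q\<close>). Its
  mass sits at \<open>q\<close> of order \<open>1 / y\<close>, so it is of exact order \<open>y powr (- (a\<^sub>2 + 1/2))\<close>. Hence the
  conditional density is of exact order \<open>w powr a\<^sub>2 * \<bar>x\<bar> powr (- (2 a\<^sub>2 + 1))\<close>, uniformly in \<open>w\<close>, and
  integrating over \<open>w\<close> only contributes the moment \<open>E (W powr a\<^sub>2)\<close>, which is positive and finite.
\<close>

section \<open>Beta and Dirichlet distributions\<close>

text \<open>Substituting \<open>x = s * u\<close> reduces to the unit interval: the Jacobian
  contributes one factor \<open>s\<close> and the two powers contribute
  \<open>s powr (a + b - 2)\<close>. The upper limit \<open>s\<close> stays free because the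
  Dirichlet integral below is computed with a varying remaining mass.\<close>

lemma nn_integral_Beta_scaled:
  fixes a b s :: real
  assumes a: "0 < a" and b: "0 < b" and s: "0 < s"
  shows "(\<integral>\<^sup>+x. ennreal (if 0 < x \<and> x < s then x powr (a - 1) * (s - x) powr (b - 1) else 0) \<partial>lborel)
    = ennreal (Beta a b * s powr (a + b - 1))"
proof -
  let ?h = "\<lambda>x::real. if 0 < x \<and> x < 1 then x powr (a - 1) * (1 - x) powr (b - 1) else 0"
  have "(\<integral>\<^sup>+x. ennreal (x powr (a - 1) * (1 - x) powr (b - 1)) * indicator {0..1} x \<partial>lborel) = ennreal (Beta a b)"
    by (rule nn_integral_has_integral_lebesgue'[OF _ has_integral_Beta_real[OF a b]]) auto
  also have "(\<integral>\<^sup>+x. ennreal (x powr (a - 1) * (1 - x) powr (b - 1)) * indicator {0..1} x \<partial>lborel)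
    = (\<integral>\<^sup>+x. ennreal (?h x) \<partial>lborel)"
    by (intro nn_integral_cong) (auto simp: indicator_def)
  finally have B: "(\<integral>\<^sup>+x. ennreal (?h x) \<partial>lborel) = ennreal (Beta a b)" .
  have "(\<integral>\<^sup>+x. ennreal (if 0 < x \<and> x < s then x powr (a - 1) * (s - x) powr (b - 1) else 0) \<partial>lborel)
    = ennreal \<bar>s\<bar> * (\<integral>\<^sup>+x. ennreal (if 0 < 0 + s * x \<and> 0 + s * x < s
        then (0 + s * x) powr (a - 1) * (s - (0 + s * x)) powr (b - 1) else 0) \<partial>lborel)"
    by (rule nn_integral_real_affine) (use s in auto)
  also have "\<dots> = ennreal s * (\<integral>\<^sup>+x. ennreal (s powr (a + b - 2)) * ennreal (?h x) \<partial>lborel)"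
  proof -
    have "(if 0 < 0 + s * x \<and> 0 + s * x < s
        then (0 + s * x) powr (a - 1) * (s - (0 + s * x)) powr (b - 1) else 0) = s powr (a + b - 2) * ?h x" for x
    proof (cases "0 < x \<and> x < 1")
      case True
      have "s - s * x = s * (1 - x)" by (simp add: algebra_simps)
      moreover have "s powr (a + b - 2) = s powr (a - 1) * s powr (b - 1)"
        by (simp add: powr_add[symmetric])
      ultimately show ?thesis using True s by (simp add: powr_mult)
    next
      case False
      then show ?thesis using s by (auto simp: zero_less_mult_iff)
    qed
    then show ?thesis using s by (simp add: ennreal_mult' cong: if_cong)
  qed
  also have "\<dots> = ennreal s * (ennreal (s powr (a + b - 2)) * ennreal (Beta a b))"
    by (subst nn_integral_cmult) (auto simp: B)
  also have "\<dots> = ennreal (s * s powr (a + b - 2) * Beta a b)"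
    using s by (simp add: ennreal_mult' mult.assoc)
  also have "s * s powr (a + b - 2) = s powr (a + b - 1)"
    using s powr_add[of s 1 "a + b - 2"] by (simp add: add.commute)
  finally show ?thesis by (simp add: mult.commute)
qed

lemma nn_integral_Beta_scaled_cmult:
  fixes a b s K :: real
  assumes "0 < a" "0 < b" "0 < s" "0 \<le> K"
  shows "(\<integral>\<^sup>+x. ennreal (if 0 < x \<and> x < s then x powr (a - 1) * (K * (s - x) powr (b - 1)) else 0) \<partial>lborel)
    = ennreal (K * Beta a b * s powr (a + b - 1))"
proof -
  have "(\<integral>\<^sup>+x. ennreal (if 0 < x \<and> x < s then x powr (a - 1) * (K * (s - x) powr (b - 1)) else 0) \<partial>lborel)
    = (\<integral>\<^sup>+x. ennreal K * ennreal (if 0 < x \<and> x < s then x powr (a - 1) * (s - x) powr (b - 1) else 0) \<partial>lborel)"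
    using assms by (intro nn_integral_cong) (auto simp: ennreal_mult'[symmetric] mult_ac)
  also have "\<dots> = ennreal K * ennreal (Beta a b * s powr (a + b - 1))"
    by (subst nn_integral_cmult) (auto simp: nn_integral_Beta_scaled assms)
  finally show ?thesis using assms by (simp add: ennreal_mult'[symmetric] mult_ac)
qed

text \<open>Induction on the index set, for all \<open>s\<close> at once: fixing coordinate
  \<open>j\<close> at \<open>y\<close> leaves the same integral with \<open>s - y\<close> in place
  of \<open>s\<close>. The outer integral over \<open>y\<close> is then a Beta integral with
  parameters \<open>\<alpha> j\<close> and \<open>A + b\<close>, whose factor
  \<open>Gamma (A + b)\<close> cancels the denominator of the induction hypothesis.\<close>

lemma nn_integral_dirichlet:
  fixes \<alpha> :: "'a \<Rightarrow> real"
  assumes "finite I" "\<And>i. i \<in> I \<Longrightarrow> 0 < \<alpha> i" "0 < b" "0 < s"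
  shows "(\<integral>\<^sup>+x. ennreal (if (\<forall>i\<in>I. 0 < x i) \<and> sum x I < s
      then (\<Prod>i\<in>I. x i powr (\<alpha> i - 1)) * (s - sum x I) powr (b - 1) else 0) \<partial>PiM I (\<lambda>_. lborel))
    = ennreal ((\<Prod>i\<in>I. Gamma (\<alpha> i)) * Gamma b / Gamma (sum \<alpha> I + b) * s powr (sum \<alpha> I + b - 1))"
  using assms(1,2,4)
proof (induction arbitrary: s rule: finite_induct)
  case empty
  then show ?case using Gamma_real_pos[OF \<open>0 < b\<close>] by (simp add: PiM_empty nn_integral_count_space_finite)
next
  case (insert j I)
  interpret product_sigma_finite "\<lambda>_. lborel" by standard
  define A where "A = sum \<alpha> I"
  define P where "P = (\<Prod>i\<in>I. Gamma (\<alpha> i))"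
  have A: "0 \<le> A" and P: "0 < P"
    unfolding A_def P_def using insert.prems
    by (auto intro!: sum_nonneg prod_pos Gamma_real_pos simp: less_imp_le)
  have j: "0 < \<alpha> j" using insert.prems by auto
  have IH: "(\<integral>\<^sup>+x. ennreal (if (\<forall>i\<in>I. 0 < x i) \<and> sum x I < t
      then (\<Prod>i\<in>I. x i powr (\<alpha> i - 1)) * (t - sum x I) powr (b - 1) else 0) \<partial>PiM I (\<lambda>_. lborel))
    = ennreal (P * Gamma b / Gamma (A + b) * t powr (A + b - 1))" if "0 < t" for t
    unfolding A_def P_def using insert.IH[OF _ that] insert.prems by auto
  let ?f = "\<lambda>x. ennreal (if (\<forall>i\<in>insert j I. 0 < x i) \<and> sum x (insert j I) < s
      then (\<Prod>i\<in>insert j I. x i powr (\<alpha> i - 1)) * (s - sum x (insert j I)) powr (b - 1) else 0)"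
  have meas: "?f \<in> borel_measurable (PiM (insert j I) (\<lambda>_. lborel))"
    using insert.hyps by (auto intro!: measurable_If pred_intros_logic pred_intros_finite)
  have "integral\<^sup>N (PiM (insert j I) (\<lambda>_. lborel)) ?f
    = (\<integral>\<^sup>+y. (\<integral>\<^sup>+x. ?f (x(j := y)) \<partial>PiM I (\<lambda>_. lborel)) \<partial>lborel)"
    using insert.hyps meas by (intro product_nn_integral_insert_rev) auto
  also have "\<dots> = (\<integral>\<^sup>+y. ennreal (if 0 < y \<and> y < s then y powr (\<alpha> j - 1) *
      (P * Gamma b / Gamma (A + b) * (s - y) powr (A + b - 1)) else 0) \<partial>lborel)"
  proof (intro nn_integral_cong)
    fix y :: real
    have [simp]: "sum (x(j := y)) I = sum x I" "(\<Prod>i\<in>I. (x(j := y)) i powr (\<alpha> i - 1)) = (\<Prod>i\<in>I. x i powr (\<alpha> i - 1))"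
      "(\<forall>i\<in>I. 0 < (x(j := y)) i) = (\<forall>i\<in>I. 0 < x i)" for x :: "'a \<Rightarrow> real"
      using insert.hyps by (auto intro!: sum.cong prod.cong)
    let ?g = "\<lambda>x. if (\<forall>i\<in>I. 0 < x i) \<and> sum x I < s - y
      then (\<Prod>i\<in>I. x i powr (\<alpha> i - 1)) * (s - y - sum x I) powr (b - 1) else 0"
    \<comment> \<open>Positive remaining coordinates have a nonnegative sum, so
      \<open>y + sum x I < s\<close> forces \<open>y < s\<close>. Hence the integrand splits into a
      factor in \<open>y\<close> alone and a Dirichlet integrand with remaining mass
      \<open>s - y\<close>.\<close>
    have eq: "?f (x(j := y)) = ennreal (if 0 < y \<and> y < s then y powr (\<alpha> j - 1) else 0) * ennreal (?g x)" for x
    proof (cases "(\<forall>i\<in>I. 0 < x i) \<and> y + sum x I < s")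
      case True
      then have "0 \<le> sum x I" by (auto intro!: sum_nonneg simp: less_imp_le)
      with True show ?thesis using insert.hyps
        by (auto simp: ennreal_mult'[symmetric] algebra_simps simp del: fun_upd_apply) (auto simp: algebra_simps)
    next
      case False
      then show ?thesis using insert.hyps
        by (auto simp: algebra_simps fun_upd_same simp del: fun_upd_apply)
    qed
    have "?g \<in> borel_measurable (PiM I (\<lambda>_. lborel))"
      using insert.hyps by (auto intro!: measurable_If pred_intros_logic pred_intros_finite)
    then have "(\<integral>\<^sup>+x. ?f (x(j := y)) \<partial>PiM I (\<lambda>_. lborel))
      = ennreal (if 0 < y \<and> y < s then y powr (\<alpha> j - 1) else 0) * (\<integral>\<^sup>+x. ennreal (?g x) \<partial>PiM I (\<lambda>_. lborel))"
      unfolding eq by (intro nn_integral_cmult) auto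
    also have "\<dots> = ennreal (if 0 < y \<and> y < s then y powr (\<alpha> j - 1) *
      (P * Gamma b / Gamma (A + b) * (s - y) powr (A + b - 1)) else 0)"
      by (cases "0 < y \<and> y < s") (auto simp: IH ennreal_mult'[symmetric])
    finally show "(\<integral>\<^sup>+x. ?f (x(j := y)) \<partial>PiM I (\<lambda>_. lborel)) = \<dots>" .
  qed
  also have "\<dots> = ennreal (P * Gamma b / Gamma (A + b) * Beta (\<alpha> j) (A + b) * s powr (\<alpha> j + (A + b) - 1))"
    using j A P \<open>0 < b\<close> insert.prems by (intro nn_integral_Beta_scaled_cmult) auto
  also have "P * Gamma b / Gamma (A + b) * Beta (\<alpha> j) (A + b)
      = (\<Prod>i\<in>insert j I. Gamma (\<alpha> i)) * Gamma b / Gamma (sum \<alpha> (insert j I) + b)"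
    using insert.hyps A \<open>0 < b\<close> Gamma_real_pos[of "A + b"]
    by (simp add: Beta_def A_def[symmetric] P_def[symmetric] add.assoc add_nonneg_pos[THEN Gamma_real_pos, THEN less_imp_neq, symmetric])
  also have "\<alpha> j + (A + b) = sum \<alpha> (insert j I) + b"
    using insert.hyps by (simp add: A_def)
  finally show ?case .
qed

section \<open>Dirichlet laws as probability measures on the simplex\<close>

lemma simplex_point_measurable:
  "simplex_point n \<in> PiM {..<n - 1} (\<lambda>_. lborel) \<rightarrow>\<^sub>M PiM {..<n} (\<lambda>_. borel)" if "0 < n"
proof -
  have eq: "{..<n} = insert (n - 1) {..<n - 1}" using that by auto
  have "(\<lambda>x. x(n - 1 := 1 - (\<Sum>i<n - 1. x i))) \<in> PiM {..<n - 1} (\<lambda>_. lborel) \<rightarrow>\<^sub>M PiM (insert (n - 1) {..<n - 1}) (\<lambda>_. borel)"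
    by (intro measurable_fun_upd[where J = "{..<n - 1}"] measurable_ident_sets) (auto cong: sets_PiM_cong)
  then show ?thesis unfolding simplex_point_def[abs_def] eq[symmetric] .
qed

lemma dirichlet_density_measurable:
  "dirichlet_density n \<alpha> \<in> borel_measurable (PiM {..<n} (\<lambda>_. borel))"
  unfolding dirichlet_density_def[abs_def]
  by (auto intro!: measurable_If pred_intros_logic pred_intros_countable_bounded)

lemma sets_dirichlet_distribution:
  "sets (dirichlet_distribution n \<alpha>) = sets (PiM {..<n} (\<lambda>_. borel))"
  by (simp add: dirichlet_distribution_def)

text \<open>The last coordinate is what the first \<open>m\<close> leave over from \<open>1\<close>,
  so its parameter \<open>\<alpha> m\<close> takes the role of \<open>b\<close> in
  \<open>nn_integral_dirichlet\<close> at \<open>s = 1\<close>. The normalising constant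
  \<open>c\<close> is the reciprocal of the value obtained there.\<close>

lemma prob_space_dirichlet_distribution:
  assumes n: "0 < n" and \<alpha>: "\<And>i. i < n \<Longrightarrow> 0 < \<alpha> i"
  shows "prob_space (dirichlet_distribution n \<alpha>)"
proof -
  obtain m where m: "n = Suc m" using n by (cases n) auto
  define c where "c = Gamma (\<Sum>i<n. \<alpha> i) / (\<Prod>i<n. Gamma (\<alpha> i))"
  have pos: "0 < (\<Sum>i<n. \<alpha> i)" "0 < (\<Prod>i<n. Gamma (\<alpha> i))"
    using n \<alpha> by (auto intro!: sum_pos prod_pos Gamma_real_pos)
  have c: "0 < c" unfolding c_def using pos by (auto intro!: divide_pos_pos Gamma_real_pos)
  have M[measurable]: "simplex_point n \<in> PiM {..<n - 1} (\<lambda>_. lborel) \<rightarrow>\<^sub>M PiM {..<n} (\<lambda>_. borel)"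
    by (rule simplex_point_measurable[OF n])
  note dirichlet_density_measurable[measurable]
  \<comment> \<open>Positivity of the last coordinate is the constraint that the others sum to less
    than \<open>1\<close>.\<close>
  have eq: "dirichlet_density n \<alpha> (simplex_point n x) = c * (if (\<forall>i\<in>{..<m}. 0 < x i) \<and> sum x {..<m} < 1
      then (\<Prod>i\<in>{..<m}. x i powr (\<alpha> i - 1)) * (1 - sum x {..<m}) powr (\<alpha> m - 1) else 0)" for x
  proof -
    have "(\<Prod>i<m. (x(m := 1 - sum x {..<m})) i powr (\<alpha> i - 1)) = (\<Prod>i<m. x i powr (\<alpha> i - 1))"
      by (intro prod.cong) auto
    then show ?thesis
      unfolding dirichlet_density_def simplex_point_def c_def m
      by (auto simp: All_less_Suc)
  qed
  have "(\<integral>\<^sup>+x. ennreal (dirichlet_density n \<alpha> (simplex_point n x)) \<partial>PiM {..<n - 1} (\<lambda>_. lborel))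
     = ennreal c * ennreal ((\<Prod>i<m. Gamma (\<alpha> i)) * Gamma (\<alpha> m) / Gamma (sum \<alpha> {..<m} + \<alpha> m) * 1 powr (sum \<alpha> {..<m} + \<alpha> m - 1))"
    unfolding eq using c
    by (subst nn_integral_dirichlet[symmetric])
      (use m \<alpha> in \<open>auto simp: ennreal_mult' intro!: nn_integral_cmult measurable_If pred_intros_logic pred_intros_finite\<close>)
  also have "\<dots> = ennreal (c * ((\<Prod>i<n. Gamma (\<alpha> i)) / Gamma (\<Sum>i<n. \<alpha> i)))"
    using c by (simp add: m ennreal_mult'[symmetric])
  also have "\<dots> = 1"
  proof -
    have "S / P * (P / S) = 1" if "0 < S" "0 < P" for S P :: real using that by simp
    from this[OF Gamma_real_pos[OF pos(1)] pos(2)] show ?thesis unfolding c_def by simp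
  qed
  finally have one: "(\<integral>\<^sup>+x. ennreal (dirichlet_density n \<alpha> (simplex_point n x)) \<partial>PiM {..<n - 1} (\<lambda>_. lborel)) = 1" .
  have "prob_space (density (PiM {..<n - 1} (\<lambda>_. lborel)) (\<lambda>x. ennreal (dirichlet_density n \<alpha> (simplex_point n x))))"
  proof
    have f: "(\<lambda>x. ennreal (dirichlet_density n \<alpha> (simplex_point n x))) \<in> borel_measurable (PiM {..<n - 1} (\<lambda>_. lborel))"
      by measurable
    show "emeasure (density (PiM {..<n - 1} (\<lambda>_. lborel)) (\<lambda>x. ennreal (dirichlet_density n \<alpha> (simplex_point n x))))
      (space (density (PiM {..<n - 1} (\<lambda>_. lborel)) (\<lambda>x. ennreal (dirichlet_density n \<alpha> (simplex_point n x))))) = 1"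
      unfolding space_density emeasure_density[OF f sets.top] one[symmetric]
      by (intro nn_integral_cong) simp
  qed
  then show ?thesis
    unfolding dirichlet_distribution_def by (rule prob_space.prob_space_distr) (use M in simp)
qed

text \<open>The density vanishes unless all coordinates are positive, and positive numbers that sum
  to \<open>1\<close> are each at most \<open>1\<close>. The upper bound is what later confines the
  weight \<open>W\<close> to \<open>(0, 1]\<close>.\<close>

lemma AE_dirichlet_distribution:
  assumes n: "0 < n"
  shows "AE x in dirichlet_distribution n \<alpha>. \<forall>i<n. 0 < x i \<and> x i \<le> 1"
proof -
  have M[measurable]: "simplex_point n \<in> PiM {..<n - 1} (\<lambda>_. lborel) \<rightarrow>\<^sub>M PiM {..<n} (\<lambda>_. borel)"
    by (rule simplex_point_measurable[OF n])
  note dirichlet_density_measurable[measurable]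
  have le: "simplex_point n x i \<le> 1" if "\<forall>i<n. 0 < simplex_point n x i" "i < n" for x i
  proof -
    have "{..<n} = insert (n - 1) {..<n - 1}" using n by auto
    then have "(\<Sum>i<n. simplex_point n x i) = 1" by (simp add: simplex_point_def)
    moreover have "simplex_point n x i \<le> (\<Sum>i<n. simplex_point n x i)"
      using that by (intro member_le_sum) (auto simp: less_imp_le)
    ultimately show ?thesis by simp
  qed
  have "Measurable.pred (PiM {..<n} (\<lambda>_. borel)) (\<lambda>x. \<forall>i<n. 0 < x i \<and> x i \<le> (1::real))"
    by (auto intro!: pred_intros_countable_bounded)
  then have S: "{x \<in> space (PiM {..<n} (\<lambda>_. borel)). \<forall>i<n. 0 < x i \<and> x i \<le> (1::real)} \<in> sets (PiM {..<n} (\<lambda>_. borel))"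
    by (rule predE)
  have "AE x in density (PiM {..<n - 1} (\<lambda>_. lborel)) (\<lambda>x. ennreal (dirichlet_density n \<alpha> (simplex_point n x))).
      \<forall>i<n. 0 < simplex_point n x i \<and> simplex_point n x i \<le> 1"
  proof (subst AE_density)
    show "AE x in PiM {..<n - 1} (\<lambda>_. lborel). 0 < ennreal (dirichlet_density n \<alpha> (simplex_point n x)) \<longrightarrow>
        (\<forall>i<n. 0 < simplex_point n x i \<and> simplex_point n x i \<le> 1)"
      by (intro AE_I2) (metis dirichlet_density_def ennreal_0 le less_irrefl)
  qed measurable
  then show ?thesis
    unfolding dirichlet_distribution_def by (subst AE_distr_iff[OF _ S]) (use M in auto)
qed

lemma prob_space_beta_distribution:
  assumes "0 < a" "0 < b"
  shows "prob_space (beta_distribution a b)"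
proof
  have "(\<lambda>x. if 0 < x \<and> x < 1 then x powr (a - 1) * (1 - x) powr (b - 1) / Beta a b else 0)
    = (\<lambda>x. if 0 < x \<and> x < 1 then x powr (a - 1) * (1 / Beta a b * (1 - x) powr (b - 1)) else 0)"
    by auto
  moreover have "0 < Beta a b" using assms by (simp add: Beta_def Gamma_real_pos)
  ultimately show "emeasure (beta_distribution a b) (space (beta_distribution a b)) = 1"
    using assms nn_integral_Beta_scaled_cmult[of a b 1 "1 / Beta a b"]
    by (simp add: beta_distribution_def emeasure_density cong: if_cong)
qed

lemma AE_beta_distribution: "AE x in beta_distribution a b. 0 < x \<and> x < 1"
  unfolding beta_distribution_def by (subst AE_density) (auto intro!: AE_I2 split: if_splits)

section \<open>Normal mixtures\<close>

text \<open>On a fixed Borel set the measure is, for \<open>0 < v\<close>, the integral of a jointly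
  measurable function, and the point mass is a separate measurable branch. The Borel sets serve as
  their own intersection-stable generator.\<close>

lemma measurable_normal_distribution:
  "normal_distribution \<mu> \<in> borel \<rightarrow>\<^sub>M prob_algebra borel"
proof (rule measurable_prob_algebra_generated[OF sets.sigma_sets_eq[symmetric] sets.Int_stable sets.space_closed])
  fix A :: "real set" assume A[measurable]: "A \<in> sets borel"
  have "emeasure (normal_distribution \<mu> v) A =
      (if 0 < v then \<integral>\<^sup>+x. ennreal (normal_density \<mu> (sqrt v) x) * indicator A x \<partial>lborel else indicator A \<mu>)" for v
    by (simp add: normal_distribution_def emeasure_density)
  then show "(\<lambda>v. emeasure (normal_distribution \<mu> v) A) \<in> borel_measurable borel"
    unfolding normal_density_def by simp
qed (auto simp: normal_distribution_def prob_space_return intro: prob_space_normal_density)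

text \<open>It suffices to test boxes with finitely many constrained coordinates: they generate the
  product and are stable under intersection, and on them the product measure is a finite product of
  measurable functions of the parameter.\<close>

lemma measurable_PiM_prob_algebra:
  assumes K: "\<And>i. i \<in> I \<Longrightarrow> K i \<in> M \<rightarrow>\<^sub>M prob_algebra (N i)"
  shows "(\<lambda>x. PiM I (\<lambda>i. K i x)) \<in> M \<rightarrow>\<^sub>M prob_algebra (PiM I N)"
proof (rule measurable_prob_algebra_generated[OF sets_PiM Int_stable_prod_algebra prod_algebra_sets_into_space])
  have K': "prob_space (K i x)" "sets (K i x) = sets (N i)" if "x \<in> space M" "i \<in> I" for x i
    using measurable_space[OF K[OF that(2)] that(1)] by (auto simp: space_prob_algebra)
  show "prob_space (PiM I (\<lambda>i. K i x))" if "x \<in> space M" for x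
    using K' that by (intro prob_space_PiM) auto
  show "sets (PiM I (\<lambda>i. K i x)) = sets (PiM I N)" if "x \<in> space M" for x
    using K' that by (intro sets_PiM_cong) auto
  fix A assume "A \<in> prod_algebra I N"
  then obtain J E where A: "A = prod_emb I N J (Pi\<^sub>E J E)" and J: "finite J" "J \<subseteq> I"
    and E: "\<And>i. i \<in> J \<Longrightarrow> E i \<in> sets (N i)"
    by (elim prod_algebraE) auto
  have "emeasure (PiM I (\<lambda>i. K i x)) A = (\<Prod>i\<in>J. emeasure (K i x) (E i))" if x: "x \<in> space M" for x
  proof -
    \<comment> \<open>\<open>prod_emb\<close> depends only on the underlying spaces, so a box over
      \<open>N\<close> is also a box over the kernel values.\<close>
    have "space (K i x) = space (N i)" if "i \<in> I" for i
      using K'(2)[OF x that] by (rule sets_eq_imp_space_eq)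
    then have "A = prod_emb I (\<lambda>i. K i x) J (Pi\<^sub>E J E)"
      unfolding A prod_emb_def by (auto cong: PiE_cong)
    then show ?thesis
      using J E K'[OF x] by (auto intro!: emeasure_PiM_emb)
  qed
  moreover have "(\<lambda>x. \<Prod>i\<in>J. emeasure (K i x) (E i)) \<in> borel_measurable M"
    using J by (intro borel_measurable_prod_ennreal measurable_emeasure_kernel[OF measurable_prob_algebraD[OF K] E]) auto
  ultimately show "(\<lambda>x. emeasure (PiM I (\<lambda>i. K i x)) A) \<in> borel_measurable M"
    by (simp cong: measurable_cong)
qed

text \<open>With \<open>u = \<bar>x\<bar> / \<bar>\<sigma>\<bar>\<close>, the density times
  \<open>\<bar>x\<bar>\<close> is \<open>u * exp (- (u\<^sup>2 / 2)) / sqrt (2 * pi)\<close>, which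
  is bounded independently of \<open>\<sigma>\<close>. At \<open>\<sigma> = 0\<close> division by
  zero makes the density \<open>0\<close>. Uniformity in \<open>\<sigma>\<close> is what lets the
  bound dominate arbitrary mixtures.\<close>

lemma normal_density_le_inverse_abs:
  assumes "x \<noteq> 0"
  shows "normal_density 0 \<sigma> x \<le> 1 / \<bar>x\<bar>"
proof (cases "\<sigma> = 0")
  case False
  define u where "u = \<bar>x\<bar> / \<bar>\<sigma>\<bar>"
  have u: "0 < u" using assms False by (simp add: u_def)
  have "u \<le> 1 + u\<^sup>2 / 2" using zero_le_power2[of "u - 1"] by (simp add: power2_diff)
  also have "\<dots> \<le> exp (u\<^sup>2 / 2)" by (rule exp_ge_add_one_self)
  finally have "u * exp (- (u\<^sup>2 / 2)) \<le> 1" by (simp add: exp_minus field_simps)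
  moreover have sq: "1 \<le> sqrt (2 * pi)" using pi_gt3 by simp
  ultimately have "u * exp (- (u\<^sup>2 / 2)) \<le> sqrt (2 * pi)" by linarith
  moreover have "normal_density 0 \<sigma> x = (u * exp (- (u\<^sup>2 / 2)) / sqrt (2 * pi)) / \<bar>x\<bar>"
    using assms False by (simp add: normal_density_def u_def power_divide real_sqrt_mult mult.commute)
  ultimately show ?thesis
    by (metis abs_ge_zero divide_le_eq_1_pos divide_right_mono less_le_trans zero_less_one sq)
qed (simp add: normal_density_def)

text \<open>The value at \<open>0\<close> is arbitrary: the integral may diverge there.\<close>

definition normal_mixture_density :: "'a measure \<Rightarrow> ('a \<Rightarrow> real) \<Rightarrow> real \<Rightarrow> real" where
  "normal_mixture_density M V x = (if x = 0 then 0 else \<integral>\<theta>. normal_density 0 (sqrt (V \<theta>)) x \<partial>M)"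

lemma (in prob_space) integrable_normal_density:
  assumes [measurable]: "V \<in> borel_measurable M" and "x \<noteq> 0"
  shows "integrable M (\<lambda>\<theta>. normal_density 0 (sqrt (V \<theta>)) x)"
proof (rule integrable_const_bound)
  show "AE \<theta> in M. norm (normal_density 0 (sqrt (V \<theta>)) x) \<le> 1 / \<bar>x\<bar>"
    using normal_density_le_inverse_abs[OF \<open>x \<noteq> 0\<close>] by auto
  show "(\<lambda>\<theta>. normal_density 0 (sqrt (V \<theta>)) x) \<in> borel_measurable M"
    unfolding normal_density_def by measurable
qed

lemma (in prob_space) ennreal_normal_mixture_density:
  assumes V: "V \<in> borel_measurable M" and "x \<noteq> 0"
  shows "ennreal (normal_mixture_density M V x) = (\<integral>\<^sup>+\<theta>. ennreal (normal_density 0 (sqrt (V \<theta>)) x) \<partial>M)"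
  using nn_integral_eq_integral[OF integrable_normal_density[OF assms]] \<open>x \<noteq> 0\<close>
  by (simp add: normal_mixture_density_def)

text \<open>Where \<open>\<bar>x\<bar>\<close> exceeds \<open>\<delta>\<close> the integrand is
  dominated by the constant \<open>1 / \<delta>\<close>, so dominated convergence gives sequential
  continuity. These open sets exhaust the complement of \<open>0\<close>.\<close>

lemma (in prob_space) continuous_on_normal_mixture_density:
  assumes V[measurable]: "V \<in> borel_measurable M"
  shows "continuous_on (- {0}) (normal_mixture_density M V)"
proof -
  have "continuous_on {x. \<delta> < \<bar>x\<bar>} (normal_mixture_density M V)" if "0 < \<delta>" for \<delta>
    unfolding continuous_on_sequentially
  proof safe
    fix X and a :: real assume a: "\<delta> < \<bar>a\<bar>" and X: "\<forall>n. X n \<in> {x. \<delta> < \<bar>x\<bar>}" and lim: "X \<longlonglongrightarrow> a"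
    have nz: "a \<noteq> 0" "X n \<noteq> 0" for n using a X \<open>0 < \<delta>\<close> by (auto simp: abs_if split: if_splits dest!: spec[of _ n])
    have "(\<lambda>n. \<integral>\<theta>. normal_density 0 (sqrt (V \<theta>)) (X n) \<partial>M) \<longlonglongrightarrow> (\<integral>\<theta>. normal_density 0 (sqrt (V \<theta>)) a \<partial>M)"
    proof (rule integral_dominated_convergence[where w = "\<lambda>_. 1 / \<delta>"])
      \<comment> \<open>Written with \<open>inverse\<close>, division by the variance is
        multiplication by a constant, so the limit also covers a vanishing variance.\<close>
      show "AE \<theta> in M. (\<lambda>n. normal_density 0 (sqrt (V \<theta>)) (X n)) \<longlonglongrightarrow> normal_density 0 (sqrt (V \<theta>)) a"
        unfolding normal_density_def divide_inverse by (intro AE_I2 tendsto_intros lim)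
      show "AE \<theta> in M. norm (normal_density 0 (sqrt (V \<theta>)) (X n)) \<le> 1 / \<delta>" for n
      proof (rule AE_I2)
        fix \<theta>
        have "1 / \<bar>X n\<bar> \<le> 1 / \<delta>" using X \<open>0 < \<delta>\<close> by (intro divide_left_mono) (auto simp: less_imp_le nz)
        then show "norm (normal_density 0 (sqrt (V \<theta>)) (X n)) \<le> 1 / \<delta>"
          using normal_density_le_inverse_abs[OF nz(2), of "sqrt (V \<theta>)" n] by simp
      qed
    qed (unfold normal_density_def, auto)
    then show "(normal_mixture_density M V \<circ> X) \<longlonglongrightarrow> normal_mixture_density M V a"
      using nz by (simp add: normal_mixture_density_def comp_def)
  qed
  then have "continuous_on (\<Union>\<delta>\<in>{0<..}. {x::real. \<delta> < \<bar>x\<bar>}) (normal_mixture_density M V)"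
    by (intro continuous_on_open_UN) (auto intro!: open_Collect_less continuous_intros)
  also have "(\<Union>\<delta>\<in>{0<..}. {x::real. \<delta> < \<bar>x\<bar>}) = - {0}"
  proof (intro set_eqI iffI)
    fix x :: real assume "x \<in> - {0}"
    then show "x \<in> (\<Union>\<delta>\<in>{0<..}. {x::real. \<delta> < \<bar>x\<bar>})" by (intro UN_I[of "\<bar>x\<bar> / 2"]) auto
  qed auto
  finally show ?thesis .
qed

text \<open>Tonelli exchanges the integral over the parameter with the one over \<open>x\<close>.
  Both conventions disappear in null sets: the point-mass branch of the normal law has probability
  \<open>0\<close> by \<open>pos\<close>, and the arbitrary value at \<open>x = 0\<close> concerns a
  single point.\<close>

lemma (in prob_space) is_density_of_normal_mixture_density:
  assumes V[measurable]: "V \<in> borel_measurable M" and pos: "AE \<theta> in M. 0 < V \<theta>"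
    and sets: "sets \<mu> = sets borel"
    and mix: "\<And>A. A \<in> sets borel \<Longrightarrow> emeasure \<mu> A = (\<integral>\<^sup>+\<theta>. emeasure (normal_distribution 0 (V \<theta>)) A \<partial>M)"
  shows "is_density_of (normal_mixture_density M V) \<mu>"
proof -
  interpret L: pair_sigma_finite M lborel by standard
  have nd[measurable]: "(\<lambda>(x, \<theta>). normal_density 0 (sqrt (V \<theta>)) x) \<in> borel_measurable (lborel \<Otimes>\<^sub>M M)"
    unfolding normal_density_def by measurable
  have nd'[measurable]: "(\<lambda>(\<theta>, x). normal_density 0 (sqrt (V \<theta>)) x) \<in> borel_measurable (M \<Otimes>\<^sub>M lborel)"
    unfolding normal_density_def by measurable
  have meas[measurable]: "normal_mixture_density M V \<in> borel_measurable borel"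
  proof -
    have "normal_mixture_density M V \<in> borel_measurable lborel"
      unfolding normal_mixture_density_def by measurable
    then show ?thesis by simp
  qed
  have "\<mu> = density lborel (\<lambda>x. ennreal (normal_mixture_density M V x))"
  proof (rule measure_eqI)
    fix A assume "A \<in> sets \<mu>"
    then have A[measurable]: "A \<in> sets borel" using sets by simp
    have "emeasure \<mu> A = (\<integral>\<^sup>+\<theta>. \<integral>\<^sup>+x. ennreal (normal_density 0 (sqrt (V \<theta>)) x) * indicator A x \<partial>lborel \<partial>M)"
      unfolding mix[OF A] using pos
      by (intro nn_integral_cong_AE) (auto simp: normal_distribution_def emeasure_density)
    also have "\<dots> = (\<integral>\<^sup>+x. \<integral>\<^sup>+\<theta>. ennreal (normal_density 0 (sqrt (V \<theta>)) x) * indicator A x \<partial>M \<partial>lborel)"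
      by (rule L.Fubini'[symmetric]) measurable
    also have "\<dots> = (\<integral>\<^sup>+x. ennreal (normal_mixture_density M V x) * indicator A x \<partial>lborel)"
    proof (rule nn_integral_cong_AE)
      show "AE x in lborel. (\<integral>\<^sup>+\<theta>. ennreal (normal_density 0 (sqrt (V \<theta>)) x) * indicator A x \<partial>M) =
        ennreal (normal_mixture_density M V x) * indicator A x"
        using AE_lborel_singleton[of 0]
      proof eventually_elim
        case (elim x)
        have "(\<lambda>\<theta>. ennreal (normal_density 0 (sqrt (V \<theta>)) x)) \<in> borel_measurable M"
          unfolding normal_density_def by measurable
        then show ?case
          using ennreal_normal_mixture_density[OF V elim] by (simp add: nn_integral_multc)
      qed
    qed
    also have "\<dots> = emeasure (density lborel (\<lambda>x. ennreal (normal_mixture_density M V x))) A"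
      by (subst emeasure_density) auto
    finally show "emeasure \<mu> A = \<dots>" .
  qed (simp add: sets)
  moreover have "0 \<le> normal_mixture_density M V x" for x
    by (simp add: normal_mixture_density_def)
  ultimately show ?thesis
    unfolding is_density_of_def using meas continuous_on_normal_mixture_density[OF V] by auto
qed

text \<open>Two versions that differ at some nonzero point differ, by continuity, on a nonempty open
  set, which has positive Lebesgue measure; but densities of one measure agree almost everywhere. So
  a tail statement proved for one version holds for all.\<close>

lemma is_density_of_unique:
  assumes f: "is_density_of f \<mu>" and f': "is_density_of f' \<mu>" and "x \<noteq> 0"
  shows "f x = f' x"
proof (rule ccontr)
  assume ne: "f x \<noteq> f' x"
  have [measurable]: "f \<in> borel_measurable borel" "f' \<in> borel_measurable borel"
    using f f' by (auto simp: is_density_of_def)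
  let ?U = "{x \<in> - {0}. f x - f' x \<in> - {0}}"
  have "continuous_on (- {0}) (\<lambda>x. f x - f' x)"
    using f f' by (auto simp: is_density_of_def intro!: continuous_intros)
  then have "open ?U"
    using continuous_open_preimage[of "- {0}" "\<lambda>x. f x - f' x" "- {0}"] by (auto simp: vimage_def Int_def)
  moreover have "?U \<noteq> {}" using ne \<open>x \<noteq> 0\<close> by auto
  ultimately have nn: "\<not> negligible ?U" by (rule open_not_negligible)
  have "AE x in lborel. ennreal (f x) = ennreal (f' x)"
    using f f' by (subst sigma_finite_measure.density_unique_iff[OF sigma_finite_lborel, symmetric]) (auto simp: is_density_of_def)
  then have "AE x in lborel. x \<notin> ?U"
    by eventually_elim (use f f' in \<open>auto simp: is_density_of_def\<close>)
  then have "?U \<in> null_sets lborel" by (subst (asm) AE_iff_null_sets[symmetric]) auto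
  then show False using nn by (simp add: negligible_iff_null_sets null_sets_completionI)
qed

section \<open>Tails of the mixture over the scale\<close>

text \<open>Raise \<open>t \<le> exp t\<close> at \<open>t = z / k\<close> to the power
  \<open>k\<close>. This trades exponential decay for power decay of a prescribed order.\<close>

lemma powr_le_exp:
  fixes k z :: real
  assumes "0 < k" "0 \<le> z"
  shows "z powr k \<le> k powr k * exp z"
proof -
  have "z / k \<le> exp (z / k)" using exp_ge_add_one_self[of "z / k"] by linarith
  then have "(z / k) powr k \<le> exp (z / k) powr k"
    using assms by (intro powr_mono2) auto
  also have "exp (z / k) powr k = exp z" using assms by (simp add: exp_powr_real)
  finally show ?thesis using assms by (simp add: powr_divide field_simps)
qed

text \<open>The exponents \<open>a - 3 / 2\<close> and \<open>b - 1 / 2\<close> occurring below may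
  have either sign; passing to \<open>\<bar>e\<bar>\<close> yields constants valid in both
  cases.\<close>

lemma powr_bounds_half_one:
  fixes e r :: real
  assumes "1 / 2 \<le> r" "r \<le> 1"
  shows "(1 / 2) powr \<bar>e\<bar> \<le> r powr e" and "r powr e \<le> 2 powr \<bar>e\<bar>"
proof -
  have "(1 / 2) powr \<bar>e\<bar> \<le> r powr \<bar>e\<bar>" using assms by (intro powr_mono2) auto
  also have "r powr \<bar>e\<bar> \<le> r powr e" using assms by (intro powr_mono') auto
  finally show "(1 / 2) powr \<bar>e\<bar> \<le> r powr e" .
  have "r powr e \<le> r powr (- \<bar>e\<bar>)" using assms by (intro powr_mono') auto
  also have "\<dots> \<le> (1 / 2) powr (- \<bar>e\<bar>)" using assms by (intro powr_mono2') auto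
  also have "\<dots> = 2 powr \<bar>e\<bar>" by (simp add: powr_minus powr_divide)
  finally show "r powr e \<le> 2 powr \<bar>e\<bar>" .
qed

lemma nn_integral_powr_exp:
  fixes k t :: real
  assumes "0 < k" "0 < t"
  shows "(\<integral>\<^sup>+q. ennreal (if 0 < q then q powr (k - 1) * exp (- (t * q)) else 0) \<partial>lborel) = ennreal (Gamma k * t powr (- k))"
proof -
  let ?G = "\<lambda>q::real. if 0 < q then q powr (k - 1) * exp (- q) else 0"
  have "ennreal (Gamma k) = (\<integral>\<^sup>+q. ennreal (indicator {0..} q * q powr (k - 1) / exp q) \<partial>lborel)"
    by (rule Gamma_conv_nn_integral_real[OF assms(1)])
  also have "\<dots> = (\<integral>\<^sup>+q. ennreal (?G q) \<partial>lborel)"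
    by (intro nn_integral_cong) (auto simp: indicator_def exp_minus field_simps)
  also have "\<dots> = ennreal \<bar>t\<bar> * (\<integral>\<^sup>+q. ennreal (?G (0 + t * q)) \<partial>lborel)"
    by (rule nn_integral_real_affine) (use assms in auto)
  also have "(\<integral>\<^sup>+q. ennreal (?G (0 + t * q)) \<partial>lborel) = (\<integral>\<^sup>+q. ennreal (t powr (k - 1)) *
      ennreal (if 0 < q then q powr (k - 1) * exp (- (t * q)) else 0) \<partial>lborel)"
    using assms by (intro nn_integral_cong) (auto simp: ennreal_mult'[symmetric] powr_mult zero_less_mult_iff)
  also have "\<dots> = ennreal (t powr (k - 1)) * (\<integral>\<^sup>+q. ennreal (if 0 < q then q powr (k - 1) * exp (- (t * q)) else 0) \<partial>lborel)"
    (is "_ = _ * ?I") by (rule nn_integral_cmult) measurable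
  finally have "ennreal (Gamma k) = ennreal (t * t powr (k - 1)) * ?I"
    using assms by (simp add: ennreal_mult' mult.assoc)
  also have "t * t powr (k - 1) = t powr k" using assms powr_add[of t 1 "k - 1"] by simp
  \<comment> \<open>Multiplying by \<open>t powr (- k)\<close> isolates the integral in
    \<open>ennreal\<close> without knowing beforehand that it is finite.\<close>
  finally have "ennreal (t powr (- k)) * ennreal (Gamma k) = ennreal (t powr (- k) * t powr k) * ?I"
    by (simp add: ennreal_mult' mult.assoc)
  also have "t powr (- k) * t powr k = 1" using assms by (simp add: powr_add[symmetric])
  finally show ?thesis by (simp add: ennreal_mult'' mult.commute)
qed

lemma nn_integral_reflect:
  fixes f :: "real \<Rightarrow> ennreal"
  assumes "f \<in> borel_measurable borel"
  shows "(\<integral>\<^sup>+x. f (t - x) \<partial>lborel) = (\<integral>\<^sup>+x. f x \<partial>lborel)"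
  using nn_integral_real_affine[OF assms, of "-1" t] by simp

text \<open>The integral in \<open>q = 1 - R\<^sup>2\<close> left over from the mixture when \<open>y = x\<^sup>2 / w\<close>.\<close>

definition beta_laplace :: "real \<Rightarrow> real \<Rightarrow> real \<Rightarrow> ennreal" where
  "beta_laplace a b y = (\<integral>\<^sup>+q. ennreal (if 0 < q \<and> q < 1
     then (1 - q) powr (a - 3 / 2) * q powr (b - 1 / 2) * exp (- (y * q / (2 * (1 - q)))) else 0) \<partial>lborel)"

text \<open>Only the range \<open>q < s = 1 / (2 * y)\<close> is kept. There the exponential and the
  power of \<open>1 - q\<close> are bounded below by constants, with product \<open>K\<close>, and
  integrating the remaining power of \<open>q\<close> up to \<open>s\<close> gives the order
  \<open>s powr (b + 1 / 2)\<close>.\<close>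

lemma beta_laplace_lower:
  assumes "0 < b"
  obtains c where "0 < c" and "\<And>y. 1 \<le> y \<Longrightarrow> ennreal (c * y powr (- (b + 1 / 2))) \<le> beta_laplace a b y"
proof
  define K where "K = (1 / 2) powr \<bar>a - 3 / 2\<bar> * exp (- (1 / 2))"
  define c where "c = K * Beta (b + 1 / 2) 1 * (1 / 2) powr (b + 1 / 2)"
  have K: "0 < K" by (simp add: K_def)
  show "0 < c" using K assms by (auto simp: c_def Beta_def intro!: mult_pos_pos divide_pos_pos Gamma_real_pos)
  fix y :: real assume y: "1 \<le> y"
  \<comment> \<open>For \<open>q < s\<close> the product \<open>y * q\<close> stays below
    \<open>1 / 2\<close>, and \<open>1 \<le> y\<close> gives \<open>s \<le> 1 / 2\<close>, so that
    \<open>2 * (1 - q)\<close> is at least \<open>1\<close>.\<close>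
  define s where "s = 1 / (2 * y)"
  have s: "0 < s" "s \<le> 1 / 2" using y by (auto simp: s_def field_simps)
  have "ennreal (c * y powr (- (b + 1 / 2))) = ennreal (K * (Beta (b + 1 / 2) 1 * s powr (b + 1 / 2 + 1 - 1)))"
    using y by (simp add: c_def s_def powr_divide powr_mult powr_minus field_simps)
  \<comment> \<open>The factor \<open>(s - q) powr (1 - 1)\<close> equals \<open>1\<close> on this
    range; it puts the power integral into Beta form.\<close>
  also have "\<dots> = (\<integral>\<^sup>+q. ennreal K * ennreal (if 0 < q \<and> q < s then q powr (b + 1 / 2 - 1) * (s - q) powr (1 - 1) else 0) \<partial>lborel)"
    using assms s K
    by (subst nn_integral_cmult) (measurable, subst nn_integral_Beta_scaled, auto simp: ennreal_mult')
  also have "\<dots> \<le> beta_laplace a b y"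
    unfolding beta_laplace_def
  proof (intro nn_integral_mono)
    fix q :: real
    show "ennreal K * ennreal (if 0 < q \<and> q < s then q powr (b + 1 / 2 - 1) * (s - q) powr (1 - 1) else 0)
      \<le> ennreal (if 0 < q \<and> q < 1
     then (1 - q) powr (a - 3 / 2) * q powr (b - 1 / 2) * exp (- (y * q / (2 * (1 - q)))) else 0)"
    proof (cases "0 < q \<and> q < s")
      case True
      then have q: "0 < q" "q < 1 / 2" using s by linarith+
      have "y * q < 1 / 2" using True y by (simp add: s_def field_simps)
      note q = q this
      have "y * q / (2 * (1 - q)) \<le> y * q / 1" using q y by (intro divide_left_mono) auto
      then have "exp (- (1 / 2)) \<le> exp (- (y * q / (2 * (1 - q))))" using q by simp
      moreover have "(1 / 2) powr \<bar>a - 3 / 2\<bar> \<le> (1 - q) powr (a - 3 / 2)"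
        using q by (intro powr_bounds_half_one) auto
      ultimately have "K \<le> (1 - q) powr (a - 3 / 2) * exp (- (y * q / (2 * (1 - q))))"
        unfolding K_def by (intro mult_mono) auto
      then have "K * q powr (b - 1 / 2) \<le> (1 - q) powr (a - 3 / 2) * exp (- (y * q / (2 * (1 - q)))) * q powr (b - 1 / 2)"
        by (intro mult_right_mono) auto
      then show ?thesis using True q K by (auto simp: ennreal_mult'[symmetric] mult_ac intro!: ennreal_leI)
    qed auto
  qed
  finally show "ennreal (c * y powr (- (b + 1 / 2))) \<le> beta_laplace a b y" .
qed

text \<open>The range is split at \<open>q = 1 / 2\<close>. For small \<open>q\<close>, dropping
  \<open>1 - q\<close> from the exponent leaves a Gamma integral. For \<open>q\<close> near
  \<open>1\<close>, with \<open>r = 1 - q\<close>, the exponential is at most a constant times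
  \<open>(r / y) powr k\<close>: this gives the required power of \<open>y\<close>, and its factor
  \<open>r powr k\<close> turns \<open>r powr (a - 3 / 2)\<close> into the integrable
  \<open>r powr (a + b - 1)\<close>.\<close>

lemma beta_laplace_upper:
  assumes "0 < a" "0 < b"
  obtains C where "0 < C" and "\<And>y. 0 < y \<Longrightarrow> beta_laplace a b y \<le> ennreal (C * y powr (- (b + 1 / 2)))"
proof
  define k where "k = b + 1 / 2"
  have k: "0 < k" using assms by (simp add: k_def)
  define K1 where "K1 = 2 powr \<bar>a - 3 / 2\<bar>"
  define K2 where "K2 = 2 powr \<bar>b - 1 / 2\<bar> * k powr k * 4 powr k"
  define C where "C = K1 * Gamma k * 2 powr k + K2 * Beta (a + b) 1"
  have K: "0 < K1" "0 < K2" using k by (auto simp: K1_def K2_def)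
  have "0 < Beta (a + b) 1" using assms by (auto simp: Beta_def intro!: mult_pos_pos divide_pos_pos Gamma_real_pos)
  then show C: "0 < C" using K k by (auto simp: C_def intro!: add_pos_pos mult_pos_pos Gamma_real_pos)
  fix y :: real assume y: "0 < y"
  let ?f1 = "\<lambda>q::real. if 0 < q then q powr (k - 1) * exp (- (y / 2 * q)) else 0"
  let ?f2 = "\<lambda>r::real. if 0 < r \<and> r < 1 then r powr (a + b - 1) * (1 - r) powr (1 - 1) else 0"
  have "beta_laplace a b y \<le> (\<integral>\<^sup>+q. ennreal K1 * ennreal (?f1 q) + ennreal (K2 * y powr (- k)) * ennreal (?f2 (1 - q)) \<partial>lborel)"
    unfolding beta_laplace_def
  proof (intro nn_integral_mono)
    fix q :: real
    have rhs: "ennreal K1 * ennreal (?f1 q) + ennreal (K2 * y powr (- k)) * ennreal (?f2 (1 - q))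
       = ennreal (K1 * ?f1 q + K2 * y powr (- k) * ?f2 (1 - q))"
      using K by (subst ennreal_plus) (auto simp: ennreal_mult')
    \<comment> \<open>Each half of the range is covered by one summand; the other is discarded as
      nonnegative.\<close>
    have nn: "0 \<le> K1 * ?f1 q" "0 \<le> K2 * y powr (- k) * ?f2 (1 - q)" using K by auto
    have "(if 0 < q \<and> q < 1
       then (1 - q) powr (a - 3 / 2) * q powr (b - 1 / 2) * exp (- (y * q / (2 * (1 - q)))) else 0)
      \<le> K1 * ?f1 q + K2 * y powr (- k) * ?f2 (1 - q)"
    proof (cases "0 < q \<and> q < 1")
      case q: True
      define r where "r = 1 - q"
      have r: "0 < r" "r < 1" using q by (auto simp: r_def)
      have lhs: "(if 0 < q \<and> q < 1
         then (1 - q) powr (a - 3 / 2) * q powr (b - 1 / 2) * exp (- (y * q / (2 * (1 - q)))) else 0)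
        = r powr (a - 3 / 2) * q powr (b - 1 / 2) * exp (- (y * q / (2 * r)))"
        using q by (simp add: r_def)
      show ?thesis
      proof (cases "1 / 2 \<le> r")
        case True
        have "y * q / 2 \<le> y * q / (2 * r)" using q r y by (intro divide_left_mono) auto
        then have "exp (- (y * q / (2 * r))) \<le> exp (- (y / 2 * q))" by simp
        moreover have "r powr (a - 3 / 2) \<le> K1"
          unfolding K1_def using True r by (intro powr_bounds_half_one) auto
        ultimately have "r powr (a - 3 / 2) * q powr (b - 1 / 2) * exp (- (y * q / (2 * r)))
          \<le> K1 * q powr (b - 1 / 2) * exp (- (y / 2 * q))"
          using K by (intro mult_mono) auto
        also have "\<dots> = K1 * ?f1 q" using q by (simp add: k_def)
        finally show ?thesis unfolding lhs using nn(2) by linarith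
      next
        case False
        have "y / (4 * r) = y * (1 / 2) / (2 * r)" by simp
        also have "\<dots> \<le> y * q / (2 * r)"
          using False r y by (intro divide_right_mono mult_left_mono) (auto simp: r_def)
        finally have "exp (- (y * q / (2 * r))) \<le> exp (- (y / (4 * r)))" by simp
        also have "\<dots> \<le> k powr k * (y / (4 * r)) powr (- k)"
          using powr_le_exp[OF k, of "y / (4 * r)"] y r k
          by (simp add: exp_minus powr_minus field_simps)
        also have "\<dots> = k powr k * 4 powr k * y powr (- k) * r powr k"
          using y r by (simp add: powr_divide powr_mult powr_minus field_simps)
        finally have E: "exp (- (y * q / (2 * r))) \<le> k powr k * 4 powr k * y powr (- k) * r powr k" .
        have "q powr (b - 1 / 2) \<le> 2 powr \<bar>b - 1 / 2\<bar>"
          using False q by (intro powr_bounds_half_one) (auto simp: r_def)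
        then have "r powr (a - 3 / 2) * q powr (b - 1 / 2) * exp (- (y * q / (2 * r)))
          \<le> r powr (a - 3 / 2) * 2 powr \<bar>b - 1 / 2\<bar> * (k powr k * 4 powr k * y powr (- k) * r powr k)"
          using E by (intro mult_mono) auto
        also have "\<dots> = K2 * y powr (- k) * (r powr (a - 3 / 2) * r powr k)"
          by (simp add: K2_def)
        also have "r powr (a - 3 / 2) * r powr k = ?f2 (1 - q)"
          using r q by (simp add: powr_add[symmetric] k_def r_def)
        finally show ?thesis unfolding lhs using nn(1) by linarith
      qed
    next
      case False
      show ?thesis unfolding if_not_P[OF False] using nn by linarith
    qed
    then show "ennreal (if 0 < q \<and> q < 1
       then (1 - q) powr (a - 3 / 2) * q powr (b - 1 / 2) * exp (- (y * q / (2 * (1 - q)))) else 0)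
      \<le> ennreal K1 * ennreal (?f1 q) + ennreal (K2 * y powr (- k)) * ennreal (?f2 (1 - q))"
      unfolding rhs by (rule ennreal_leI)
  qed
  also have "\<dots> = ennreal K1 * (\<integral>\<^sup>+q. ennreal (?f1 q) \<partial>lborel)
      + ennreal (K2 * y powr (- k)) * (\<integral>\<^sup>+q. ennreal (?f2 (1 - q)) \<partial>lborel)"
    by (subst nn_integral_add) (auto simp: nn_integral_cmult)
  also have "(\<integral>\<^sup>+q. ennreal (?f2 (1 - q)) \<partial>lborel) = (\<integral>\<^sup>+r. ennreal (?f2 r) \<partial>lborel)"
    by (rule nn_integral_reflect[where f = "\<lambda>r. ennreal (?f2 r)"]) measurable
  also have "\<dots> = ennreal (Beta (a + b) 1 * 1 powr (a + b + 1 - 1))"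
    using assms by (intro nn_integral_Beta_scaled) auto
  also have "(\<integral>\<^sup>+q. ennreal (?f1 q) \<partial>lborel) = ennreal (Gamma k * (y / 2) powr (- k))"
    using k y by (intro nn_integral_powr_exp) auto
  also have "(y / 2) powr (- k) = 2 powr k * y powr (- k)"
    using y by (simp add: powr_divide powr_minus field_simps)
  also have "ennreal K1 * ennreal (Gamma k * (2 powr k * y powr (- k)))
      + ennreal (K2 * y powr (- k)) * ennreal (Beta (a + b) 1 * 1 powr (a + b + 1 - 1))
    = ennreal (C * y powr (- k))"
    using K k Gamma_real_pos[OF k] \<open>0 < Beta (a + b) 1\<close>
    by (simp add: C_def ennreal_mult'[symmetric] ennreal_plus[symmetric] algebra_simps del: ennreal_plus)
  finally show "beta_laplace a b y \<le> ennreal (C * y powr (- (b + 1 / 2)))" by (simp add: k_def)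
qed

text \<open>The prefactor of the normal density contributes
  \<open>(w * (r / (1 - r))) powr (- (1 / 2))\<close>. This shifts the Beta exponents
  \<open>a - 1\<close> and \<open>b - 1\<close> to \<open>a - 3 / 2\<close> and
  \<open>b - 1 / 2\<close>, and the reflection \<open>q = 1 - r\<close> produces
  \<open>beta_laplace\<close>.\<close>

lemma nn_integral_normal_density_beta:
  assumes a: "0 < a" and b: "0 < b" and w: "0 < w"
  shows "(\<integral>\<^sup>+r. ennreal (normal_density 0 (sqrt (w * (r / (1 - r)))) x) \<partial>beta_distribution a b) =
    ennreal (1 / (Beta a b * sqrt (2 * pi)) * w powr (- (1 / 2))) * beta_laplace a b (x\<^sup>2 / w)"
proof -
  define C0 where "C0 = 1 / (Beta a b * sqrt (2 * pi))"
  have B: "0 < Beta a b" using a b by (simp add: Beta_def Gamma_real_pos)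
  have C0: "0 < C0" using B by (simp add: C0_def)
  let ?d = "\<lambda>r. if 0 < r \<and> r < 1 then r powr (a - 1) * (1 - r) powr (b - 1) / Beta a b else 0"
  let ?n = "\<lambda>r. normal_density 0 (sqrt (w * (r / (1 - r)))) x"
  let ?k = "\<lambda>q. if 0 < q \<and> q < 1
     then (1 - q) powr (a - 3 / 2) * q powr (b - 1 / 2) * exp (- (x\<^sup>2 / w * q / (2 * (1 - q)))) else 0"
  have meas: "?n \<in> borel_measurable borel"
    unfolding normal_density_def by measurable
  have eq: "?d r * ?n r = C0 * w powr (- (1 / 2)) * ?k (1 - r)" for r
  proof (cases "0 < r \<and> r < 1")
    case True
    have n: "?n r = 1 / sqrt (2 * pi) * w powr (- (1 / 2)) * r powr (- (1 / 2)) * (1 - r) powr (1 / 2)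
       * exp (- (x\<^sup>2 / w * (1 - r) / (2 * r)))"
      using True w
      by (simp add: normal_density_def real_sqrt_mult real_sqrt_divide powr_half_sqrt powr_minus field_simps)
    have p: "r powr (a - 1) * r powr (- (1 / 2)) = r powr (a - 3 / 2)"
      "(1 - r) powr (b - 1) * (1 - r) powr (1 / 2) = (1 - r) powr (b - 1 / 2)"
      by (simp_all add: powr_add[symmetric])
    have "?d r * ?n r = C0 * w powr (- (1 / 2)) * ((r powr (a - 1) * r powr (- (1 / 2)))
        * ((1 - r) powr (b - 1) * (1 - r) powr (1 / 2)) * exp (- (x\<^sup>2 / w * (1 - r) / (2 * r))))"
      unfolding n C0_def using True by simp
    then show ?thesis unfolding p using True by simp
  qed auto
  have "(\<integral>\<^sup>+r. ennreal (?n r) \<partial>beta_distribution a b) = (\<integral>\<^sup>+r. ennreal (?d r) * ennreal (?n r) \<partial>lborel)"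
    unfolding beta_distribution_def using meas by (subst nn_integral_density) auto
  also have "\<dots> = (\<integral>\<^sup>+r. ennreal (?d r * ?n r) \<partial>lborel)"
    by (intro nn_integral_cong) (subst ennreal_mult'', auto)
  also have "\<dots> = (\<integral>\<^sup>+r. ennreal (C0 * w powr (- (1 / 2)) * ?k (1 - r)) \<partial>lborel)"
    unfolding eq ..
  also have "\<dots> = (\<integral>\<^sup>+q. ennreal (C0 * w powr (- (1 / 2)) * ?k q) \<partial>lborel)"
    by (rule nn_integral_reflect[where f = "\<lambda>q. ennreal (C0 * w powr (- (1 / 2)) * ?k q)"]) measurable
  also have "\<dots> = (\<integral>\<^sup>+q. ennreal (C0 * w powr (- (1 / 2))) * ennreal (?k q) \<partial>lborel)"
    using C0 by (intro nn_integral_cong ennreal_mult') auto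
  also have "\<dots> = ennreal (C0 * w powr (- (1 / 2))) * beta_laplace a b (x\<^sup>2 / w)"
    unfolding beta_laplace_def by (subst nn_integral_cmult) auto
  finally show ?thesis by (simp add: C0_def)
qed

text \<open>For \<open>w \<le> 1\<close> and \<open>\<bar>x\<bar> \<ge> 1\<close> the argument
  \<open>x\<^sup>2 / w\<close> is at least \<open>1\<close>, so both estimates of
  \<open>beta_laplace\<close> apply with constants independent of \<open>w\<close>. The prefactor
  \<open>w powr (- (1 / 2))\<close> combines with \<open>w powr (b + 1 / 2)\<close> to
  \<open>w powr b\<close>.\<close>

lemma nn_integral_normal_density_beta_bounds:
  assumes a: "0 < a" and b: "0 < b"
  obtains c C where "0 < c" "0 < C"
    "\<And>w x. \<lbrakk>0 < w; w \<le> 1; 1 \<le> \<bar>x\<bar>\<rbrakk> \<Longrightarrow> ennreal (c * w powr b * \<bar>x\<bar> powr (- (2 * b + 1)))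
      \<le> (\<integral>\<^sup>+r. ennreal (normal_density 0 (sqrt (w * (r / (1 - r)))) x) \<partial>beta_distribution a b)"
    "\<And>w x. \<lbrakk>0 < w; w \<le> 1; 1 \<le> \<bar>x\<bar>\<rbrakk> \<Longrightarrow>
      (\<integral>\<^sup>+r. ennreal (normal_density 0 (sqrt (w * (r / (1 - r)))) x) \<partial>beta_distribution a b)
      \<le> ennreal (C * w powr b * \<bar>x\<bar> powr (- (2 * b + 1)))"
proof -
  define C0 where "C0 = 1 / (Beta a b * sqrt (2 * pi))"
  have C0: "0 < C0" using a b by (simp add: C0_def Beta_def Gamma_real_pos)
  obtain c where c: "0 < c" and lower: "\<And>y. 1 \<le> y \<Longrightarrow> ennreal (c * y powr (- (b + 1 / 2))) \<le> beta_laplace a b y"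
    using beta_laplace_lower[OF b] by blast
  obtain C where C: "0 < C" and upper: "\<And>y. 0 < y \<Longrightarrow> beta_laplace a b y \<le> ennreal (C * y powr (- (b + 1 / 2)))"
    using beta_laplace_upper[OF a b] by blast
  have scale: "ennreal (C0 * D * w powr b * \<bar>x\<bar> powr (- (2 * b + 1)))
      = ennreal (C0 * w powr (- (1 / 2))) * ennreal (D * (x\<^sup>2 / w) powr (- (b + 1 / 2)))"
    if "0 < w" "1 \<le> \<bar>x\<bar>" "0 < D" for w x D :: real
  proof -
    have "(x\<^sup>2) powr (- (b + 1 / 2)) = \<bar>x\<bar> powr (- (2 * b + 1))"
    proof -
      have "x\<^sup>2 = \<bar>x\<bar> powr 2" using that by simp
      moreover have "2 * - (b + 1 / 2) = - (2 * b + 1)" by simp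
      moreover have "(\<bar>x\<bar> powr 2) powr (- (b + 1 / 2)) = \<bar>x\<bar> powr (2 * - (b + 1 / 2))" by (rule powr_powr)
      ultimately show ?thesis by (simp only:)
    qed
    then have A: "(x\<^sup>2 / w) powr (- (b + 1 / 2)) = \<bar>x\<bar> powr (- (2 * b + 1)) * w powr (b + 1 / 2)"
      using that powr_divide[of "x\<^sup>2" w "- (b + 1 / 2)"] powr_minus[of w "b + 1 / 2"]
      by (simp only: divide_inverse inverse_inverse_eq zero_le_power2 less_imp_le)
    have B: "w powr (- (1 / 2)) * w powr (b + 1 / 2) = w powr b" by (simp add: powr_add[symmetric])
    have "C0 * D * w powr b * \<bar>x\<bar> powr (- (2 * b + 1))
        = C0 * w powr (- (1 / 2)) * (D * (x\<^sup>2 / w) powr (- (b + 1 / 2)))"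
      unfolding A B[symmetric] by (simp only: mult_ac)
    then show ?thesis using C0 by (simp only: ennreal_mult' mult_nonneg_nonneg less_imp_le powr_ge_zero)
  qed
  have y: "1 \<le> x\<^sup>2 / w" if "0 < w" "w \<le> 1" "1 \<le> \<bar>x\<bar>" for w x :: real
  proof -
    have "1 \<le> x\<^sup>2" using that abs_le_square_iff[of 1 x] by simp
    then show ?thesis using that by simp
  qed
  note eq = nn_integral_normal_density_beta[OF a b, folded C0_def]
  show thesis
  proof (rule that[of "C0 * c" "C0 * C"])
    fix w x :: real assume wx: "0 < w" "w \<le> 1" "1 \<le> \<bar>x\<bar>"
    show "ennreal (C0 * c * w powr b * \<bar>x\<bar> powr (- (2 * b + 1)))
      \<le> (\<integral>\<^sup>+r. ennreal (normal_density 0 (sqrt (w * (r / (1 - r)))) x) \<partial>beta_distribution a b)"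
      unfolding scale[OF wx(1,3) c] eq[OF wx(1)] using y[OF wx] by (intro mult_left_mono lower) auto
    show "(\<integral>\<^sup>+r. ennreal (normal_density 0 (sqrt (w * (r / (1 - r)))) x) \<partial>beta_distribution a b)
      \<le> ennreal (C0 * C * w powr b * \<bar>x\<bar> powr (- (2 * b + 1)))"
      unfolding scale[OF wx(1,3) C] eq[OF wx(1)] using y[OF wx] by (intro mult_left_mono upper) auto
  qed (use C0 c C in auto)
qed

section \<open>Marginals of the Group-R2 prior\<close>

text \<open>An exceptional null set in one factor becomes a null rectangle in the product, even if
  the other factor is infinite, since zero times infinity is zero in \<open>ennreal\<close>.\<close>

lemma AE_pair_measure_fst:
  assumes "sigma_finite_measure N" "AE x in M. P x"
  shows "AE z in M \<Otimes>\<^sub>M N. P (fst z)"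
proof -
  interpret N: sigma_finite_measure N by fact
  from assms(2) obtain S where S: "{x \<in> space M. \<not> P x} \<subseteq> S" "S \<in> sets M" "emeasure M S = 0" by (rule AE_E)
  then have "S \<times> space N \<in> null_sets (M \<Otimes>\<^sub>M N)"
    by (intro null_setsI) (auto simp: N.emeasure_pair_measure_Times)
  then show ?thesis by (rule AE_I') (use S in \<open>auto simp: space_pair_measure\<close>)
qed

lemma AE_pair_measure_snd:
  assumes "sigma_finite_measure N" "AE y in N. P y"
  shows "AE z in M \<Otimes>\<^sub>M N. P (snd z)"
proof -
  interpret N: sigma_finite_measure N by fact
  from assms(2) obtain S where S: "{x \<in> space N. \<not> P x} \<subseteq> S" "S \<in> sets N" "emeasure N S = 0" by (rule AE_E)
  then have "space M \<times> S \<in> null_sets (M \<Otimes>\<^sub>M N)"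
    by (intro null_setsI) (auto simp: N.emeasure_pair_measure_Times)
  then show ?thesis by (rule AE_I') (use S in \<open>auto simp: space_pair_measure\<close>)
qed

section \<open>Reduction of the marginal of one coefficient to a normal mixture\<close>

definition coeff_variance :: "nat \<Rightarrow> nat \<Rightarrow> r2_hyper \<Rightarrow> real" where
  "coeff_variance g l = (\<lambda>(\<tau>2, \<phi>, \<psi>). \<psi> g l * \<phi> g * \<tau>2)"

lemma measurable_coeff_variance:
  assumes "g < G" "l < p g"
  shows "coeff_variance g l \<in> borel_measurable (r2_hyper_space G p)"
proof -
  have g: "g \<in> {..<G}" using assms by simp
  have 1: "(\<lambda>\<theta>::r2_hyper. fst (snd \<theta>) g) \<in> borel_measurable (r2_hyper_space G p)"
    unfolding r2_hyper_space_def using g by measurable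
  have "(\<lambda>\<theta>::r2_hyper. snd (snd \<theta>) g) \<in> r2_hyper_space G p \<rightarrow>\<^sub>M PiM {..<p g} (\<lambda>_. borel)"
    unfolding r2_hyper_space_def using g by measurable
  from measurable_compose[OF this measurable_component_singleton[of l]]
  have 2: "(\<lambda>\<theta>::r2_hyper. snd (snd \<theta>) g l) \<in> borel_measurable (r2_hyper_space G p)"
    using assms by auto
  have 3: "(\<lambda>\<theta>::r2_hyper. fst \<theta>) \<in> borel_measurable (r2_hyper_space G p)"
    unfolding r2_hyper_space_def by measurable
  show ?thesis
    using 1 2 3 unfolding coeff_variance_def by (simp add: case_prod_unfold)
qed

lemma r2_coeff_law_eq:
  "r2_coeff_law G p \<theta> = PiM (r2_coeff_index G p) (\<lambda>i. normal_distribution 0 (coeff_variance (fst i) (snd i) \<theta>))"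
  by (simp add: r2_coeff_law_def coeff_variance_def case_prod_unfold)

lemma measurable_r2_coeff_law:
  "r2_coeff_law G p \<in> r2_hyper_space G p \<rightarrow>\<^sub>M prob_algebra (r2_coeff_space G p)"
  unfolding r2_coeff_law_eq[abs_def] r2_coeff_space_def
  by (intro measurable_PiM_prob_algebra measurable_compose[OF measurable_coeff_variance measurable_normal_distribution])
    (auto simp: r2_coeff_index_def)

text \<open>The projection to the coefficient is moved inside the outer bind. For fixed
  hyperparameters the joint kernel is the image of the coefficient law under
  \<open>Pair \<theta>\<close>, and one component of a product of probability measures has the
  corresponding factor as its law.\<close>

lemma emeasure_coeff_marginal:
  assumes H: "sets (r2_hyper_law G p aG a2 c) = sets (r2_hyper_space G p)"
    and gl: "g < G" "l < p g" and A: "A \<in> sets borel"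
  shows "emeasure (coeff_marginal G p aG a2 c g l) A =
    (\<integral>\<^sup>+\<theta>. emeasure (normal_distribution 0 (coeff_variance g l \<theta>)) A \<partial>r2_hyper_law G p aG a2 c)"
proof -
  let ?H = "r2_hyper_law G p aG a2 c" and ?S = "r2_hyper_space G p" and ?C = "r2_coeff_space G p"
  define K where "K \<theta> = r2_coeff_law G p \<theta> \<bind> (\<lambda>b. return (?S \<Otimes>\<^sub>M ?C) (\<theta>, b))" for \<theta>
  have gl': "(g, l) \<in> r2_coeff_index G p" using gl by (simp add: r2_coeff_index_def)
  have ne: "space ?S \<noteq> {}" by (auto simp: r2_hyper_space_def space_pair_measure space_PiM PiE_eq_empty_iff)
  have sH: "space ?H = space ?S" by (rule sets_eq_imp_space_eq[OF H])
  have L: "r2_coeff_law G p \<in> ?S \<rightarrow>\<^sub>M prob_algebra ?C" by (rule measurable_r2_coeff_law)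
  have KS: "K \<in> ?S \<rightarrow>\<^sub>M prob_algebra (?S \<Otimes>\<^sub>M ?C)"
    unfolding K_def[abs_def] by (rule measurable_bind_prob_space2[OF L]) measurable
  then have K: "K \<in> ?H \<rightarrow>\<^sub>M prob_algebra (?S \<Otimes>\<^sub>M ?C)"
    by (simp cong: measurable_cong_sets add: H)
  have b: "(\<lambda>b. b (g, l)) \<in> borel_measurable ?C"
    unfolding r2_coeff_space_def by (rule measurable_component_singleton[OF gl'])
  then have b2: "(\<lambda>(\<theta>, b). b (g, l)) \<in> borel_measurable (?S \<Otimes>\<^sub>M ?C)"
    by simp
  have "coeff_marginal G p aG a2 c g l = ?H \<bind> (\<lambda>\<theta>. distr (K \<theta>) borel (\<lambda>(\<theta>, b). b (g, l)))"
    unfolding coeff_marginal_def group_r2_prior_def K_def[symmetric]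
    using K b2 ne sH by (intro distr_bind measurable_prob_algebraD) auto
  also have "\<dots> = ?H \<bind> (\<lambda>\<theta>. normal_distribution 0 (coeff_variance g l \<theta>))"
  proof (rule bind_cong[OF refl])
    fix \<theta> assume "\<theta> \<in> space ?H"
    then have \<theta>: "\<theta> \<in> space ?S" using sH by simp
    have LL: "prob_space (r2_coeff_law G p \<theta>)" "sets (r2_coeff_law G p \<theta>) = sets ?C"
      using measurable_space[OF L \<theta>] by (auto simp: space_prob_algebra)
    have Pr: "Pair \<theta> \<in> r2_coeff_law G p \<theta> \<rightarrow>\<^sub>M ?S \<Otimes>\<^sub>M ?C"
      using \<theta> LL by (simp cong: measurable_cong_sets)
    have "K \<theta> = distr (r2_coeff_law G p \<theta>) (?S \<Otimes>\<^sub>M ?C) (Pair \<theta>)"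
      unfolding K_def by (rule bind_return_distr'[OF prob_space.not_empty[OF LL(1)] Pr])
    then have "distr (K \<theta>) borel (\<lambda>(\<theta>, b). b (g, l)) = distr (r2_coeff_law G p \<theta>) borel (\<lambda>b. b (g, l))"
      using b2 Pr by (simp add: distr_distr comp_def)
    \<comment> \<open>\<open>distr\<close> uses only the sigma-algebra of its target, so the normal
      law may replace \<open>borel\<close>, to fit the form of
      \<open>distr_PiM_component\<close>.\<close>
    also have "\<dots> = distr (r2_coeff_law G p \<theta>) (normal_distribution 0 (coeff_variance g l \<theta>)) (\<lambda>b. b (g, l))"
      by (intro distr_cong) (auto simp: normal_distribution_def)
    also have "\<dots> = normal_distribution 0 (coeff_variance g l \<theta>)"
      unfolding r2_coeff_law_eq
      using distr_PiM_component[of "r2_coeff_index G p" "\<lambda>i. normal_distribution 0 (coeff_variance (fst i) (snd i) \<theta>)" "(g, l)"]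
        measurable_space[OF measurable_normal_distribution] gl'
      by (simp add: space_prob_algebra)
    finally show "distr (K \<theta>) borel (\<lambda>(\<theta>, b). b (g, l)) = normal_distribution 0 (coeff_variance g l \<theta>)" .
  qed
  finally have eq: "coeff_marginal G p aG a2 c g l = ?H \<bind> (\<lambda>\<theta>. normal_distribution 0 (coeff_variance g l \<theta>))" .
  have "(\<lambda>\<theta>. normal_distribution 0 (coeff_variance g l \<theta>)) \<in> ?S \<rightarrow>\<^sub>M prob_algebra borel"
    by (rule measurable_compose[OF measurable_coeff_variance[of g G l p, OF gl] measurable_normal_distribution])
  then have "(\<lambda>\<theta>. normal_distribution 0 (coeff_variance g l \<theta>)) \<in> ?H \<rightarrow>\<^sub>M prob_algebra borel"
    by (simp cong: measurable_cong_sets add: H)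
  then show ?thesis
    unfolding eq using ne sH A by (intro emeasure_bind measurable_prob_algebraD) auto
qed

text \<open>Collecting all proportions in one factor exhibits the hyperparameter law as a product in
  which \<open>\<tau>\<^sup>2\<close> is independent of the weight \<open>W\<close>.\<close>

definition proportion_law :: "nat \<Rightarrow> (nat \<Rightarrow> nat) \<Rightarrow> real \<Rightarrow> (nat \<Rightarrow> real) \<Rightarrow> ((nat \<Rightarrow> real) \<times> (nat \<Rightarrow> nat \<Rightarrow> real)) measure" where
  "proportion_law G p aG c = dirichlet_distribution G (\<lambda>_. aG) \<Otimes>\<^sub>M PiM {..<G} (\<lambda>h. dirichlet_distribution (p h) (\<lambda>_. c h))"

lemma r2_hyper_law_eq: "r2_hyper_law G p aG a2 c = tau2_law G aG a2 \<Otimes>\<^sub>M proportion_law G p aG c"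
  by (simp add: r2_hyper_law_def proportion_law_def)

lemma sets_proportion_law:
  "sets (proportion_law G p aG c) = sets (PiM {..<G} (\<lambda>_. borel) \<Otimes>\<^sub>M PiM {..<G} (\<lambda>h. PiM {..<p h} (\<lambda>_. borel)))"
  unfolding proportion_law_def
  by (intro sets_pair_measure_cong sets_PiM_cong sets_dirichlet_distribution refl)

lemma sets_r2_hyper_law: "sets (r2_hyper_law G p aG a2 c) = sets (r2_hyper_space G p)"
  unfolding r2_hyper_law_eq r2_hyper_space_def
  by (intro sets_pair_measure_cong sets_proportion_law) (simp add: tau2_law_def)

lemma measurable_odds: "(\<lambda>r::real. r / (1 - r)) \<in> beta_distribution a b \<rightarrow>\<^sub>M borel"
  by (simp add: beta_distribution_def)

lemma prob_space_tau2_law: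
  assumes "1 \<le> G" "0 < aG" "0 < a2"
  shows "prob_space (tau2_law G aG a2)"
  unfolding tau2_law_def
  by (intro prob_space.prob_space_distr prob_space_beta_distribution measurable_odds) (use assms in auto)

lemma AE_tau2_law_pos: "AE t in tau2_law G aG a2. 0 < t"
  unfolding tau2_law_def
proof (subst AE_distr_iff[OF measurable_odds])
  show "AE r in beta_distribution (real G * aG) a2. 0 < r / (1 - r)"
    using AE_beta_distribution by eventually_elim auto
qed simp

section \<open>Density and tail bounds for one fixed coefficient\<close>

context
  fixes G :: nat and p :: "nat \<Rightarrow> nat" and aG :: real and c :: "nat \<Rightarrow> real" and g l :: nat
  assumes p: "\<And>h. h < G \<Longrightarrow> 1 \<le> p h" and aG: "0 < aG" and c: "\<And>h. h < G \<Longrightarrow> 0 < c h"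
    and g: "g < G" and l: "l < p g"
begin

lemma prob_space_proportion_law: "prob_space (proportion_law G p aG c)"
  unfolding proportion_law_def
proof (intro prob_space_pair prob_space_PiM prob_space_dirichlet_distribution)
  show "0 < p h" if "h \<in> {..<G}" for h using p[of h] that by simp
qed (use g aG c in auto)

lemma measurable_proportion: "(\<lambda>\<omega>. snd \<omega> g l * fst \<omega> g) \<in> borel_measurable (proportion_law G p aG c)"
proof -
  have g': "g \<in> {..<G}" and l': "l \<in> {..<p g}" using g l by auto
  let ?N = "PiM {..<G} (\<lambda>_. borel) \<Otimes>\<^sub>M PiM {..<G} (\<lambda>h. PiM {..<p h} (\<lambda>_. borel)) :: ((nat \<Rightarrow> real) \<times> (nat \<Rightarrow> nat \<Rightarrow> real)) measure"
  have 1: "(\<lambda>\<omega>. fst \<omega> g) \<in> borel_measurable ?N" using g' by measurable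
  have "(\<lambda>\<omega>. snd \<omega> g) \<in> ?N \<rightarrow>\<^sub>M PiM {..<p g} (\<lambda>_. borel)" using g' by measurable
  from measurable_compose[OF this measurable_component_singleton[OF l']] 1
  have "(\<lambda>\<omega>. snd \<omega> g l * fst \<omega> g) \<in> borel_measurable ?N" by simp
  then show ?thesis by (simp cong: measurable_cong_sets add: sets_proportion_law)
qed

text \<open>Both factors of the weight are coordinates of Dirichlet vectors, hence almost surely in
  \<open>(0, 1]\<close>; these null sets lift from the factors to the product. This is the range of
  \<open>w\<close> in which the uniform tail bounds hold.\<close>

lemma AE_proportion: "AE \<omega> in proportion_law G p aG c. 0 < snd \<omega> g l * fst \<omega> g \<and> snd \<omega> g l * fst \<omega> g \<le> 1"
proof -
  let ?D = "\<lambda>h. dirichlet_distribution (p h) (\<lambda>_. c h)"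
  have prob: "prob_space (?D h)" if "h \<in> {..<G}" for h
    using p[of h] c[of h] that by (intro prob_space_dirichlet_distribution) auto
  have D: "sigma_finite_measure (PiM {..<G} ?D)"
    by (intro prob_space_imp_sigma_finite prob_space_PiM prob)
  have "AE \<psi> in ?D g. 0 < \<psi> l \<and> \<psi> l \<le> 1"
    using AE_dirichlet_distribution[of "p g" "\<lambda>_. c g"] l by auto
  then have "AE \<psi> in PiM {..<G} ?D. 0 < \<psi> g l \<and> \<psi> g l \<le> 1"
    using g by (intro AE_PiM_component[where P = "\<lambda>x. 0 < x l \<and> x l \<le> 1"] prob) auto
  from AE_pair_measure_snd[OF D this]
  have \<psi>: "AE \<omega> in proportion_law G p aG c. 0 < snd \<omega> g l \<and> snd \<omega> g l \<le> 1"
    unfolding proportion_law_def .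
  have "AE \<phi> in dirichlet_distribution G (\<lambda>_. aG). 0 < \<phi> g \<and> \<phi> g \<le> 1"
    using AE_dirichlet_distribution[of G "\<lambda>_. aG"] g by auto
  from AE_pair_measure_fst[OF D this]
  have "AE \<omega> in proportion_law G p aG c. 0 < fst \<omega> g \<and> fst \<omega> g \<le> 1"
    unfolding proportion_law_def .
  with \<psi> show ?thesis
    by eventually_elim (auto intro: mult_le_one)
qed

lemma AE_coeff_variance_pos: "AE \<theta> in r2_hyper_law G p aG a2 c. 0 < coeff_variance g l \<theta>"
proof -
  have "sigma_finite_measure (proportion_law G p aG c)"
    by (intro prob_space_imp_sigma_finite prob_space_proportion_law)
  note sf = this
  have "AE \<theta> in r2_hyper_law G p aG a2 c. 0 < fst \<theta>"
    "AE \<theta> in r2_hyper_law G p aG a2 c. 0 < snd (snd \<theta>) g l * fst (snd \<theta>) g \<and> snd (snd \<theta>) g l * fst (snd \<theta>) g \<le> 1"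
    unfolding r2_hyper_law_eq
    by (rule AE_pair_measure_fst[OF sf AE_tau2_law_pos] AE_pair_measure_snd[OF sf AE_proportion])+
  then show ?thesis
    by eventually_elim (auto simp: coeff_variance_def case_prod_unfold)
qed

lemma prob_space_r2_hyper_law:
  assumes "0 < a2" shows "prob_space (r2_hyper_law G p aG a2 c)"
  unfolding r2_hyper_law_eq using assms g aG
  by (intro prob_space_pair prob_space_tau2_law prob_space_proportion_law) auto

lemma measurable_coeff_variance_hyper_law: "coeff_variance g l \<in> borel_measurable (r2_hyper_law G p aG a2 c)"
  using measurable_coeff_variance[of g G l p, OF g l] by (simp cong: measurable_cong_sets add: sets_r2_hyper_law)

lemma is_density_of_coeff_marginal:
  assumes "0 < a2"
  shows "is_density_of (normal_mixture_density (r2_hyper_law G p aG a2 c) (coeff_variance g l)) (coeff_marginal G p aG a2 c g l)"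
  by (intro prob_space.is_density_of_normal_mixture_density prob_space_r2_hyper_law measurable_coeff_variance_hyper_law
      AE_coeff_variance_pos emeasure_coeff_marginal sets_r2_hyper_law assms g l) (auto simp: coeff_marginal_def)

text \<open>Tonelli puts the scale innermost and pulls it back to the Beta variable
  \<open>r\<close>, so the inner integral is the fixed-weight mixture already estimated.\<close>

lemma nn_integral_r2_hyper_law:
  assumes a2: "0 < a2" and f[measurable]: "f \<in> borel_measurable borel"
  shows "(\<integral>\<^sup>+\<theta>. f (coeff_variance g l \<theta>) \<partial>r2_hyper_law G p aG a2 c) =
    (\<integral>\<^sup>+\<omega>. \<integral>\<^sup>+r. f (snd \<omega> g l * fst \<omega> g * (r / (1 - r))) \<partial>beta_distribution (real G * aG) a2 \<partial>proportion_law G p aG c)"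
proof -
  have "1 \<le> G" using g by simp
  interpret T: prob_space "tau2_law G aG a2" by (rule prob_space_tau2_law[OF \<open>1 \<le> G\<close> aG a2])
  interpret P: prob_space "proportion_law G p aG c" by (rule prob_space_proportion_law)
  interpret TP: pair_sigma_finite "tau2_law G aG a2" "proportion_law G p aG c" by standard
  have m: "(\<lambda>\<theta>. f (coeff_variance g l \<theta>)) \<in> borel_measurable (tau2_law G aG a2 \<Otimes>\<^sub>M proportion_law G p aG c)"
    using measurable_compose[OF measurable_coeff_variance_hyper_law f] unfolding r2_hyper_law_eq .
  have "(\<integral>\<^sup>+\<theta>. f (coeff_variance g l \<theta>) \<partial>r2_hyper_law G p aG a2 c) =
    (\<integral>\<^sup>+\<omega>. \<integral>\<^sup>+t. f (coeff_variance g l (t, \<omega>)) \<partial>tau2_law G aG a2 \<partial>proportion_law G p aG c)"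
    unfolding r2_hyper_law_eq by (rule TP.nn_integral_snd[OF m, symmetric])
  also have "\<dots> = (\<integral>\<^sup>+\<omega>. \<integral>\<^sup>+t. f (snd \<omega> g l * fst \<omega> g * t) \<partial>tau2_law G aG a2 \<partial>proportion_law G p aG c)"
    by (simp add: coeff_variance_def case_prod_unfold)
  also have "\<dots> = (\<integral>\<^sup>+\<omega>. \<integral>\<^sup>+r. f (snd \<omega> g l * fst \<omega> g * (r / (1 - r))) \<partial>beta_distribution (real G * aG) a2 \<partial>proportion_law G p aG c)"
    unfolding tau2_law_def by (intro nn_integral_cong nn_integral_distr measurable_odds) measurable
  finally show ?thesis .
qed

text \<open>The fixed-weight bounds depend on the weight only through \<open>w powr a2\<close>, so
  integrating them multiplies both constants by the same moment \<open>K\<close>.\<close>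

lemma coeff_density_bounds:
  fixes a2 :: real
  defines "f \<equiv> normal_mixture_density (r2_hyper_law G p aG a2 c) (coeff_variance g l)"
  assumes a2: "0 < a2"
  obtains d D where "0 < d" "0 < D"
    "\<And>x. 1 \<le> \<bar>x\<bar> \<Longrightarrow> d * \<bar>x\<bar> powr (- (2 * a2 + 1)) \<le> f x"
    "\<And>x. 1 \<le> \<bar>x\<bar> \<Longrightarrow> f x \<le> D * \<bar>x\<bar> powr (- (2 * a2 + 1))"
proof -
  let ?P = "proportion_law G p aG c"
  let ?W = "\<lambda>\<omega>. snd \<omega> g l * fst \<omega> g :: real"
  have "0 < real G * aG" using g aG by auto
  then obtain d D where dD: "0 < d" "0 < D" and
    lower: "\<And>w x. \<lbrakk>0 < w; w \<le> 1; 1 \<le> \<bar>x\<bar>\<rbrakk> \<Longrightarrow> ennreal (d * w powr a2 * \<bar>x\<bar> powr (- (2 * a2 + 1)))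
      \<le> (\<integral>\<^sup>+r. ennreal (normal_density 0 (sqrt (w * (r / (1 - r)))) x) \<partial>beta_distribution (real G * aG) a2)" and
    upper: "\<And>w x. \<lbrakk>0 < w; w \<le> 1; 1 \<le> \<bar>x\<bar>\<rbrakk> \<Longrightarrow>
      (\<integral>\<^sup>+r. ennreal (normal_density 0 (sqrt (w * (r / (1 - r)))) x) \<partial>beta_distribution (real G * aG) a2)
      \<le> ennreal (D * w powr a2 * \<bar>x\<bar> powr (- (2 * a2 + 1)))"
    using nn_integral_normal_density_beta_bounds[OF _ a2] by blast
  interpret P: prob_space ?P by (rule prob_space_proportion_law)
  note measurable_proportion[measurable]
  have int: "integrable ?P (\<lambda>\<omega>. ?W \<omega> powr a2)"
  proof (rule P.integrable_const_bound)
    show "AE \<omega> in ?P. norm (?W \<omega> powr a2) \<le> 1"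
      using AE_proportion by eventually_elim (use a2 in \<open>auto intro: powr_le1\<close>)
  qed measurable
  define K where "K = (\<integral>\<omega>. ?W \<omega> powr a2 \<partial>?P)"
  have K0: "0 \<le> K" by (simp add: K_def)
  \<comment> \<open>A vanishing moment would force the weight to be \<open>0\<close> almost surely,
    against its almost sure positivity.\<close>
  have "K \<noteq> 0"
  proof
    assume "K = 0"
    then have "AE \<omega> in ?P. ?W \<omega> powr a2 = 0"
      using integral_nonneg_eq_0_iff_AE[OF int] by (simp add: K_def)
    then have "AE \<omega> in ?P. False" using AE_proportion by eventually_elim auto
    then show False by simp
  qed
  with K0 have K: "0 < K" by simp
  have moment: "(\<integral>\<^sup>+\<omega>. ennreal (e * ?W \<omega> powr a2 * u) \<partial>?P) = ennreal (e * K * u)" if "0 \<le> e" "0 \<le> u" for e u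
  proof -
    have "(\<integral>\<^sup>+\<omega>. ennreal (e * ?W \<omega> powr a2 * u) \<partial>?P) = ennreal (\<integral>\<omega>. e * ?W \<omega> powr a2 * u \<partial>?P)"
      using int that by (intro nn_integral_eq_integral) auto
    then show ?thesis by (simp add: K_def)
  qed
  have f: "ennreal (f x) = (\<integral>\<^sup>+\<omega>. \<integral>\<^sup>+r. ennreal (normal_density 0 (sqrt (?W \<omega> * (r / (1 - r)))) x)
      \<partial>beta_distribution (real G * aG) a2 \<partial>?P)" if "1 \<le> \<bar>x\<bar>" for x
  proof -
    have "(\<lambda>v. ennreal (normal_density 0 (sqrt v) x)) \<in> borel_measurable borel"
      unfolding normal_density_def by measurable
    from nn_integral_r2_hyper_law[OF a2 this] show ?thesis
      unfolding f_def using that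
      by (subst prob_space.ennreal_normal_mixture_density[OF prob_space_r2_hyper_law[OF a2] measurable_coeff_variance_hyper_law]) auto
  qed
  have f0: "0 \<le> f x" for x by (simp add: f_def normal_mixture_density_def)
  show thesis
  proof (rule that[of "d * K" "D * K"])
    fix x :: real assume x: "1 \<le> \<bar>x\<bar>"
    have "ennreal (d * K * \<bar>x\<bar> powr (- (2 * a2 + 1))) = (\<integral>\<^sup>+\<omega>. ennreal (d * ?W \<omega> powr a2 * \<bar>x\<bar> powr (- (2 * a2 + 1))) \<partial>?P)"
      using dD by (intro moment[symmetric]) auto
    also have "\<dots> \<le> ennreal (f x)"
      unfolding f[OF x]
      by (rule nn_integral_mono_AE, rule AE_mp[OF AE_proportion], intro AE_I2 impI, rule lower) (use x in auto)
    finally show "d * K * \<bar>x\<bar> powr (- (2 * a2 + 1)) \<le> f x" using f0 by simp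
    have "ennreal (f x) \<le> (\<integral>\<^sup>+\<omega>. ennreal (D * ?W \<omega> powr a2 * \<bar>x\<bar> powr (- (2 * a2 + 1))) \<partial>?P)"
      unfolding f[OF x]
      by (rule nn_integral_mono_AE, rule AE_mp[OF AE_proportion], intro AE_I2 impI, rule upper) (use x in auto)
    also have "\<dots> = ennreal (D * K * \<bar>x\<bar> powr (- (2 * a2 + 1)))"
      using dD by (intro moment) auto
    finally show "f x \<le> D * K * \<bar>x\<bar> powr (- (2 * a2 + 1))" using dD K by (simp add: ennreal_le_iff)
  qed (use dD K in auto)
qed

end

section \<open>Comparison with the Cauchy tail\<close>

lemma filterlim_abs_at_infinity: "filterlim (\<lambda>x::real. \<bar>x\<bar>) at_top at_infinity"
  using filterlim_norm_at_top[where 'a = real] by (simp add: real_norm_def[abs_def])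

lemma cauchy_density_bigo: "cauchy_density \<in> O[at_infinity](\<lambda>x. \<bar>x\<bar> powr (- 2))"
proof (rule bigoI[where c = 1])
  have "norm (cauchy_density x) \<le> 1 * norm (\<bar>x\<bar> powr (- 2))" if "1 \<le> norm x" for x :: real
  proof -
    have "x\<^sup>2 \<le> pi * (1 + x\<^sup>2)" using pi_gt3 mult_right_mono[of 1 pi "1 + x\<^sup>2"] by simp
    moreover have "0 < x\<^sup>2" using that by auto
    ultimately have "1 / (pi * (1 + x\<^sup>2)) \<le> 1 / x\<^sup>2" by (intro divide_left_mono mult_pos_pos) (auto intro: add_pos_nonneg)
    moreover have "\<bar>x\<bar> powr (- 2) = 1 / x\<^sup>2" using that by (simp add: powr_minus_divide)
    moreover have "0 \<le> 1 / (pi * (1 + x\<^sup>2))" by simp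
    ultimately show ?thesis by (simp add: cauchy_density_def)
  qed
  then show "\<forall>\<^sub>F x in at_infinity. norm (cauchy_density x) \<le> 1 * norm (\<bar>x\<bar> powr (- 2))"
    unfolding eventually_at_infinity by blast
qed

theorem proposition6:
  fixes G :: nat and p :: "nat \<Rightarrow> nat" and aG a2 :: real and c :: "nat \<Rightarrow> real"
    and g l :: nat
  assumes "G \<ge> 1" and "\<And>h. h < G \<Longrightarrow> p h \<ge> 1"
    and "aG > 0" and "a2 > 0"
    and "\<And>h. h < G \<Longrightarrow> c h = aG / real (p h)"
    and "g < G" and "l < p g"
  shows "(\<exists>f. is_density_of f (coeff_marginal G p aG a2 c g l)) \<and>
    (\<forall>f. is_density_of f (coeff_marginal G p aG a2 c g l) \<longrightarrow>
       f \<in> \<Theta>[at_infinity](\<lambda>b. 1 / \<bar>b\<bar> powr (2 * a2 + 1)) \<and>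
       (a2 \<le> 1 / 2 \<longrightarrow> cauchy_density \<in> O[at_infinity](f)) \<and>
       (a2 < 1 / 2 \<longrightarrow> cauchy_density \<in> o[at_infinity](f)))"
proof -
  let ?\<mu> = "coeff_marginal G p aG a2 c g l"
  define f0 where "f0 = normal_mixture_density (r2_hyper_law G p aG a2 c) (coeff_variance g l)"
  have c: "0 < c h" if "h < G" for h
    using assms(2,5)[OF that] \<open>0 < aG\<close> by simp
  have f0: "is_density_of f0 ?\<mu>"
    unfolding f0_def using assms c by (intro is_density_of_coeff_marginal) auto
  obtain d D where dD: "0 < d" "0 < D"
    and lower: "\<And>x. 1 \<le> \<bar>x\<bar> \<Longrightarrow> d * \<bar>x\<bar> powr (- (2 * a2 + 1)) \<le> f0 x"
    and upper: "\<And>x. 1 \<le> \<bar>x\<bar> \<Longrightarrow> f0 x \<le> D * \<bar>x\<bar> powr (- (2 * a2 + 1))"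
    unfolding f0_def using coeff_density_bounds[of G p aG c g l a2] assms c by metis
  \<comment> \<open>The bounds are known for the mixture \<open>f0\<close>; every other admissible
    version coincides with it away from \<open>0\<close>.\<close>
  have main: "f \<in> \<Theta>[at_infinity](\<lambda>b. \<bar>b\<bar> powr (- (2 * a2 + 1)))" if f: "is_density_of f ?\<mu>" for f
  proof (rule bigthetaI)
    have eq: "f x = f0 x" if "1 \<le> \<bar>x\<bar>" for x
      using is_density_of_unique[OF f f0] that by auto
    have nonneg: "0 \<le> f x" for x using f by (simp add: is_density_of_def)
    show "f \<in> O[at_infinity](\<lambda>b. \<bar>b\<bar> powr (- (2 * a2 + 1)))"
      using upper nonneg
      by (intro bigoI[where c = D]) (auto simp: eventually_at_infinity eq intro!: exI[of _ 1])
    show "f \<in> \<Omega>[at_infinity](\<lambda>b. \<bar>b\<bar> powr (- (2 * a2 + 1)))"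
      using lower nonneg dD
      by (intro landau_omega.bigI[where c = d]) (auto simp: eventually_at_infinity eq intro!: exI[of _ 1])
  qed
  have "cauchy_density \<in> O[at_infinity](f)" if f: "is_density_of f ?\<mu>" and "a2 \<le> 1 / 2" for f
  proof -
    \<comment> \<open>Comparing powers means comparing exponents:
      \<open>- 2 \<le> - (2 * a2 + 1)\<close> amounts to \<open>a2 \<le> 1 / 2\<close>. At equality
      both tails have order \<open>\<bar>x\<bar> powr (- 2)\<close>, which is why the little-o
      statement requires strictness.\<close>
    have "(\<lambda>x::real. \<bar>x\<bar> powr (- 2)) \<in> O[at_infinity](\<lambda>x. \<bar>x\<bar> powr (- (2 * a2 + 1)))"
      using powr_bigo_iff[OF filterlim_abs_at_infinity trivial_limit_at_infinity] that(2) by simp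
    from landau_o.big_trans[OF cauchy_density_bigo this] show ?thesis
      unfolding landau_o.big.cong_bigtheta[OF main[OF f]] .
  qed
  moreover have "cauchy_density \<in> o[at_infinity](f)" if f: "is_density_of f ?\<mu>" and "a2 < 1 / 2" for f
  proof -
    have "(\<lambda>x::real. \<bar>x\<bar> powr (- 2)) \<in> o[at_infinity](\<lambda>x. \<bar>x\<bar> powr (- (2 * a2 + 1)))"
      using powr_smallo_iff[OF filterlim_abs_at_infinity trivial_limit_at_infinity] that(2) by simp
    from landau_o.big_small_trans[OF cauchy_density_bigo this] show ?thesis
      unfolding landau_o.small.cong_bigtheta[OF main[OF f]] .
  qed
  moreover have "(\<lambda>b. 1 / \<bar>b\<bar> powr (2 * a2 + 1)) = (\<lambda>b. \<bar>b\<bar> powr (- (2 * a2 + 1)))"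
    by (simp only: powr_minus_divide)
  ultimately show ?thesis using f0 main by auto
qed

end
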